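(* Put $b_{s,t}^{(\mathfrak l)}:=\lambda^*_{s,t}+\lambda_{s,t}$ and $b_{s,t}^{(\mathfrak r)}:=\rho^*_{s,t}+\rho_{s,t}$ on monotone Fock space $\Gamma$. Then for every $n\ge0$ and every pattern $\delta=(\delta_1,\ldots,\delta_{2n})\in\{\mathfrak l,\mathfrak r\}^{2n}$, $$\langle\Omega,b_{0,1}^{(\delta_1)}\cdots b_{0,1}^{(\delta_{2n})}\Omega\rangle=\frac{1}{n!}\,\#\mathrm{PP}_{\bowtie}(\delta),$$ and for patterns $\delta$ of odd length $m$ one has $\langle\Omega,b_{0,1}^{(\delta_1)}\cdots b_{0,1}^{(\delta_m)}\Omega\rangle=0$.
   Context: Monotone Fock space: let $\mathbb R^*=\bigcup_{n\ge0}\mathbb R^n$ carry the measure whose restriction to each $\mathbb R^n$ is $n$-dimensional Lebesgue measure ($\mathbb R^0=\{\Lambda\}$, the empty tuple, with mass $1$), let $\Delta=\{(t_1,\ldots,t_n)\in\mathbb R^*\mid t_1<\cdots<t_n\}$ with the restricted measure, and $\Gamma=L^2(\Delta)$. $\Omega\in\Gamma$ is the function with value $1$ at $\Lambda$ and $0$ elsewhere. For $f\in L^2(\mathbb R)$ the bounded operators $\lambda^*(f),\rho^*(f)$ on $\Gamma$ are $$(\lambda^*(f)g)(t_1,\ldots,t_n)=f(t_1)g(t_2,\ldots,t_n),\quad(\rho^*(f)g)(t_1,\ldots,t_n)=g(t_1,\ldots,t_{n-1})f(t_n)\quad(n>0),$$ both vanishing at $\Lambda$, and their adjoints $\lambda(f),\rho(f)$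 are $$(\lambda(f)g)(t_1,\ldots,t_n)=\int_{-\infty}^{t_1}\overline{f(\tau)}g(\tau,t_1,\ldots,t_n)\,d\tau,\quad(\rho(f)g)(t_1,\ldots,t_n)=\int_{t_n}^{\infty}\overline{f(\tau)}g(t_1,\ldots,t_n,\tau)\,d\tau$$ (for $n=0$ the integrals are over $\mathbb R$). Put $\lambda^*_{s,t}=\lambda^*(1_{[s,t]})$, $\lambda_{s,t}=\lambda(1_{[s,t]})$, $\rho^*_{s,t}=\rho^*(1_{[s,t]})$, $\rho_{s,t}=\rho(1_{[s,t]})$. An ordered two-faced partition of a set $X$ is a partition of $X$ into nonempty blocks with a total order $\le$ on the set of blocks, together with a map $\delta\colon X\to\{\mathfrak l,\mathfrak r\}$ (the pattern), $x\mapsto\delta_x$; it is a pair partition if all blocks have exactly two elements. For totally ordered $X$ it is called bi-monotone if for all $a<b<c$ in $X$ and blocks $V,W$ with $a,c\in V$, $b\in W$: $V\ge W$ if $\delta(b)=\mathfrak r$ and $V\le W$ if $\delta(b)=\mathfrak l$. $\mathrm{PP}_{\bowtie}(\delta)$ is the set of all bi-monotone (ordered) pair partitions of $\{1,\ldots,2n\}$ with pattern $\delta$; the same underlying partition with different block orders counts as different elements. *)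

theory Defs
  imports "HOL-Analysis.Analysis" "HOL-Library.Disjoint_Sets"
begin

section \<open>Monotone Fock space\<close>

text \<open>Real tuples of arbitrary length are lists. A set of tuples is measurable if each of its
  sections of fixed length is, and its measure is the sum of the Lebesgue measures of the sections.
  For \<open>n = 0\<close> the product measure is the unit mass on the one-point space.\<close>

abbreviation lborel_tuple :: "nat \<Rightarrow> (nat \<Rightarrow> real) measure" where
  "lborel_tuple n \<equiv> PiM {..<n} (\<lambda>_. lborel)"

definition tuple_section :: "real list set \<Rightarrow> nat \<Rightarrow> (nat \<Rightarrow> real) set" where
  "tuple_section A n = {x \<in> space (lborel_tuple n). map x [0..<n] \<in> A}"

definition tuples :: "real list measure" where
  "tuples = measure_of UNIV
     {A. \<forall>n. tuple_section A n \<in> sets (lborel_tuple n)}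
     (\<lambda>A. \<Sum>n. emeasure (lborel_tuple n) (tuple_section A n))"

definition increasing_tuples :: "real list set" where
  "increasing_tuples = {ts. sorted_wrt (<) ts}"

definition inc_tuples :: "real list measure" where
  "inc_tuples = restrict_space tuples increasing_tuples"

definition square_integrable :: "'a measure \<Rightarrow> ('a \<Rightarrow> complex) \<Rightarrow> bool" where
  "square_integrable M f \<longleftrightarrow> f \<in> borel_measurable M \<and> integrable M (\<lambda>x. (cmod (f x))\<^sup>2)"


subsection \<open>Measure-theoretic facts\<close>

lemma sigma_algebra_tuples:
  "sigma_algebra UNIV {A. \<forall>n. tuple_section A n \<in> sets (lborel_tuple n)}"
proof (rule sigma_algebra_iff2[THEN iffD2], intro conjI ballI allI impI)
  show "{} \<in> {A. \<forall>n. tuple_section A n \<in> sets (lborel_tuple n)}"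
    by (simp add: tuple_section_def)
next
  fix A assume A: "A \<in> {A. \<forall>n. tuple_section A n \<in> sets (lborel_tuple n)}"
  have "tuple_section (UNIV - A) n = space (lborel_tuple n) - tuple_section A n" for n
    by (auto simp: tuple_section_def)
  then show "UNIV - A \<in> {A. \<forall>n. tuple_section A n \<in> sets (lborel_tuple n)}"
    using A by auto
next
  fix A :: "nat \<Rightarrow> real list set"
  assume A: "range A \<subseteq> {A. \<forall>n. tuple_section A n \<in> sets (lborel_tuple n)}"
  have "tuple_section (\<Union>(range A)) n = (\<Union>i. tuple_section (A i) n)" for n
    by (auto simp: tuple_section_def)
  then show "\<Union>(range A) \<in> {A. \<forall>n. tuple_section A n \<in> sets (lborel_tuple n)}"
    using A by (simp add: image_subset_iff sets.countable_UN)
qed simp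

lemma space_tuples [simp]: "space tuples = UNIV"
  by (simp add: tuples_def space_measure_of_conv)

lemma sets_tuples: "sets tuples = {A. \<forall>n. tuple_section A n \<in> sets (lborel_tuple n)}"
  unfolding tuples_def
  by (subst sets_measure_of) (auto simp: sigma_algebra.sigma_sets_eq[OF sigma_algebra_tuples])

lemma emeasure_tuples:
  assumes "A \<in> sets tuples"
  shows "emeasure tuples A = (\<Sum>n. emeasure (lborel_tuple n) (tuple_section A n))"
proof (rule emeasure_measure_of[OF tuples_def])
  show "positive (sets tuples) (\<lambda>A. \<Sum>n. emeasure (lborel_tuple n) (tuple_section A n))"
    by (simp add: positive_def tuple_section_def)
  show "countably_additive (sets tuples) (\<lambda>A. \<Sum>n. emeasure (lborel_tuple n) (tuple_section A n))"
  proof (rule countably_additiveI)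
    fix A :: "nat \<Rightarrow> real list set"
    assume A: "range A \<subseteq> sets tuples" "disjoint_family A"
    have U: "tuple_section (\<Union>(range A)) n = (\<Union>i. tuple_section (A i) n)" for n
      by (auto simp: tuple_section_def)
    have "(\<Sum>i. \<Sum>n. emeasure (lborel_tuple n) (tuple_section (A i) n))
        = (\<Sum>n. \<Sum>i. emeasure (lborel_tuple n) (tuple_section (A i) n))"
      using nn_integral_suminf[of
          "\<lambda>i n. emeasure (lborel_tuple n) (tuple_section (A i) n)" "count_space UNIV"]
      by (simp add: nn_integral_count_space_nat)
    also have "\<dots> = (\<Sum>n. emeasure (lborel_tuple n) (tuple_section (\<Union>(range A)) n))"
      unfolding U
    proof (intro suminf_cong suminf_emeasure)
      fix n
      show "range (\<lambda>i. tuple_section (A i) n) \<subseteq> sets (lborel_tuple n)"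
        using A(1) by (auto simp: sets_tuples)
      show "disjoint_family (\<lambda>i. tuple_section (A i) n)"
        using A(2) by (fastforce simp: disjoint_family_on_def tuple_section_def)
    qed
    finally show "(\<Sum>i. \<Sum>n. emeasure (lborel_tuple n) (tuple_section (A i) n))
        = (\<Sum>n. emeasure (lborel_tuple n) (tuple_section (\<Union>(range A)) n))" .
  qed
qed (use assms in \<open>auto simp: sets_tuples\<close>)

lemma measurable_tuples_iff:
  "f \<in> measurable tuples N \<longleftrightarrow> (\<forall>n. (\<lambda>x. f (map x [0..<n])) \<in> measurable (lborel_tuple n) N)"
proof -
  have eq: "tuple_section (f -` A) n = (\<lambda>x. f (map x [0..<n])) -` A \<inter> space (lborel_tuple n)" for A n
    by (auto simp: tuple_section_def)
  have "\<exists>x\<in>space (lborel_tuple (length ts)). ts = map x [0..<length ts]" for ts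
    by (rule bexI[of _ "restrict (nth ts) {..<length ts}"])
      (auto simp: space_PiM intro!: nth_equalityI)
  then have "range f \<subseteq> space N \<longleftrightarrow> (\<forall>n. \<forall>x\<in>space (lborel_tuple n). f (map x [0..<n]) \<in> space N)"
    by (auto simp: subset_eq) metis
  then show ?thesis
    unfolding measurable_def by (auto simp: sets_tuples eq)
qed

lemma measurable_map_upt:
  assumes "\<And>i. i < n \<Longrightarrow> (\<lambda>x. h x i) \<in> borel_measurable N"
  shows "(\<lambda>x. map (h x) [0..<n]) \<in> measurable N tuples"
proof -
  have *: "(\<lambda>x. map x [0..<n]) \<in> measurable (lborel_tuple n) tuples"
  proof (rule measurableI)
    fix A assume "A \<in> sets tuples"
    then have "tuple_section A n \<in> sets (lborel_tuple n)" by (simp add: sets_tuples)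
    then show "(\<lambda>x. map x [0..<n]) -` A \<inter> space (lborel_tuple n) \<in> sets (lborel_tuple n)"
      by (simp add: tuple_section_def vimage_def Int_def conj_commute)
  qed simp
  have "(\<lambda>x. \<lambda>i\<in>{..<n}. h x i) \<in> measurable N (lborel_tuple n)"
    using assms by (intro measurable_restrict) simp
  from measurable_compose[OF this *] show ?thesis
    by (rule measurable_cong[THEN iffD1, rotated]) simp
qed

lemma nn_integral_tuples:
  assumes "g \<in> borel_measurable tuples"
  shows "(\<integral>\<^sup>+ts. g ts \<partial>tuples) = (\<Sum>n. \<integral>\<^sup>+x. g (map x [0..<n]) \<partial>lborel_tuple n)"
  using assms
proof (induction rule: borel_measurable_induct)
  case (cong f g)
  then show ?case by simp
next
  case (set A)
  have "(\<integral>\<^sup>+x. indicator A (map x [0..<n]) \<partial>lborel_tuple n)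
      = emeasure (lborel_tuple n) (tuple_section A n)" for n
  proof -
    have "(\<integral>\<^sup>+x. indicator A (map x [0..<n]) \<partial>lborel_tuple n)
        = (\<integral>\<^sup>+x. indicator (tuple_section A n) x \<partial>lborel_tuple n)"
      by (intro nn_integral_cong) (auto simp: tuple_section_def indicator_def)
    then show ?thesis
      using set by (simp add: sets_tuples)
  qed
  then show ?case using set by (simp add: emeasure_tuples)
next
  case (mult u c)
  then show ?case by (simp add: nn_integral_cmult measurable_tuples_iff ennreal_suminf_cmult)
next
  case (add u v)
  then show ?case
    by (simp add: nn_integral_add measurable_tuples_iff suminf_add[OF summableI summableI, symmetric])
next
  case (seq U)
  have inc: "incseq (\<lambda>i x. U i (map x [0..<n]))" for n
    using seq by (auto simp: incseq_def le_fun_def)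
  have "(\<integral>\<^sup>+ts. (SUP i. U i) ts \<partial>tuples) = (SUP i. \<integral>\<^sup>+ts. U i ts \<partial>tuples)"
    unfolding SUP_apply using seq by (intro nn_integral_monotone_convergence_SUP) auto
  also have "\<dots> = (SUP i. \<Sum>n. \<integral>\<^sup>+x. U i (map x [0..<n]) \<partial>lborel_tuple n)"
    using seq by simp
  also have "\<dots> = (SUP i. \<integral>\<^sup>+n. (\<integral>\<^sup>+x. U i (map x [0..<n]) \<partial>lborel_tuple n) \<partial>count_space UNIV)"
    by (simp add: nn_integral_count_space_nat)
  also have "\<dots> = (\<integral>\<^sup>+n. (SUP i. \<integral>\<^sup>+x. U i (map x [0..<n]) \<partial>lborel_tuple n) \<partial>count_space UNIV)"
    using seq(3) by (intro nn_integral_monotone_convergence_SUP[symmetric])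
      (auto simp: incseq_def le_fun_def intro!: nn_integral_mono)
  also have "\<dots> = (\<Sum>n. \<integral>\<^sup>+x. (SUP i. U i) (map x [0..<n]) \<partial>lborel_tuple n)"
    unfolding nn_integral_count_space_nat SUP_apply
    using seq inc
    by (intro suminf_cong nn_integral_monotone_convergence_SUP[symmetric])
      (auto simp: measurable_tuples_iff)
  finally show ?case .
qed

interpretation lborel_tuple: product_sigma_finite "\<lambda>_::nat. lborel :: real measure" ..

lemma measurable_Cons_map_upt:
  "(\<lambda>(\<tau>, x). \<tau> # map x [0..<n]) \<in> measurable (lborel \<Otimes>\<^sub>M lborel_tuple n) tuples"
proof -
  have eq: "\<tau> # map x [0..<n] = map (case_nat \<tau> x) [0..<Suc n]" for \<tau> :: real and x
    by (simp add: upt_conv_Cons map_Suc_upt[symmetric] del: upt_Suc)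
  show ?thesis
    unfolding eq split_beta'
    by (intro measurable_map_upt) (auto split: nat.split)
qed

lemma measurable_snoc_map_upt:
  "(\<lambda>(\<tau>, x). map x [0..<n] @ [\<tau>]) \<in> measurable (lborel \<Otimes>\<^sub>M lborel_tuple n) tuples"
proof -
  have eq: "map x [0..<n] @ [\<tau>] = map (\<lambda>i. if i = n then \<tau> else x i) [0..<Suc n]"
    for \<tau> :: real and x by simp
  show ?thesis
    unfolding eq split_beta'
  proof (intro measurable_map_upt)
    fix i assume "i < Suc n"
    then show "(\<lambda>p. if i = n then fst p else snd p i) \<in> borel_measurable (lborel \<Otimes>\<^sub>M lborel_tuple n)"
      by (cases "i = n") auto
  qed
qed

lemma nn_integral_lborel_tuple_Suc_front:
  assumes g: "g \<in> borel_measurable tuples"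
  shows "(\<integral>\<^sup>+x. g (map x [0..<Suc n]) \<partial>lborel_tuple (Suc n))
    = (\<integral>\<^sup>+\<tau>. (\<integral>\<^sup>+x. g (\<tau> # map x [0..<n]) \<partial>lborel_tuple n) \<partial>lborel)"
proof -
  let ?c = "\<lambda>(\<tau>::real, x). \<lambda>i\<in>{..<Suc n}. case_nat \<tau> x i"
  interpret T: finite_product_sigma_finite "\<lambda>_::nat. lborel :: real measure" "{..<n}"
    by standard simp
  have c: "?c \<in> measurable (lborel \<Otimes>\<^sub>M lborel_tuple n) (lborel_tuple (Suc n))"
    unfolding split_beta' by (intro measurable_restrict) (auto split: nat.split)
  have "distr (lborel \<Otimes>\<^sub>M lborel_tuple n) (lborel_tuple (Suc n)) ?c = lborel_tuple (Suc n)"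
  proof (rule lborel_tuple.PiM_eqI)
    fix A :: "nat \<Rightarrow> real set"
    assume A: "\<And>i. i \<in> {..<Suc n} \<Longrightarrow> A i \<in> sets lborel"
    have "?c (\<tau>, x) \<in> Pi\<^sub>E {..<Suc n} A \<longleftrightarrow> \<tau> \<in> A 0 \<and> (\<forall>i<n. x i \<in> A (Suc i))" for \<tau> x
    proof -
      have "?c (\<tau>, x) \<in> Pi\<^sub>E {..<Suc n} A \<longleftrightarrow> (\<forall>i<Suc n. case_nat \<tau> x i \<in> A i)"
        by (auto simp: restrict_PiE_iff PiE_iff Pi_iff)
      then show ?thesis by (simp only: All_less_Suc2 nat.case)
    qed
    then have vimage: "?c -` Pi\<^sub>E {..<Suc n} A \<inter> space (lborel \<Otimes>\<^sub>M lborel_tuple n)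
        = A 0 \<times> Pi\<^sub>E {..<n} (\<lambda>i. A (Suc i))"
      by (simp only: set_eq_iff split_paired_All Int_iff vimage_eq space_pair_measure space_PiM
          mem_Times_iff fst_conv snd_conv PiE_iff) auto
    have "emeasure (distr (lborel \<Otimes>\<^sub>M lborel_tuple n) (lborel_tuple (Suc n)) ?c) (Pi\<^sub>E {..<Suc n} A)
        = emeasure (lborel \<Otimes>\<^sub>M lborel_tuple n) (A 0 \<times> Pi\<^sub>E {..<n} (\<lambda>i. A (Suc i)))"
      unfolding vimage[symmetric] using A by (intro emeasure_distr c sets_PiM_I_finite) simp_all
    also have "\<dots> = emeasure lborel (A 0) * emeasure (lborel_tuple n) (Pi\<^sub>E {..<n} (\<lambda>i. A (Suc i)))"
      using A by (intro T.emeasure_pair_measure_Times sets_PiM_I_finite) simp_all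
    also have "emeasure (lborel_tuple n) (Pi\<^sub>E {..<n} (\<lambda>i. A (Suc i)))
        = (\<Prod>i<n. emeasure lborel (A (Suc i)))"
      using A by (intro lborel_tuple.emeasure_PiM) simp_all
    also have "emeasure lborel (A 0) * \<dots> = (\<Prod>i\<in>{..<Suc n}. emeasure lborel (A i))"
      by (rule prod.lessThan_Suc_shift[symmetric])
    finally show "emeasure (distr (lborel \<Otimes>\<^sub>M lborel_tuple n) (lborel_tuple (Suc n)) ?c)
        (Pi\<^sub>E {..<Suc n} A) = (\<Prod>i\<in>{..<Suc n}. emeasure lborel (A i))" .
  qed simp_all
  then have "(\<integral>\<^sup>+x. g (map x [0..<Suc n]) \<partial>lborel_tuple (Suc n))
    = (\<integral>\<^sup>+x. g (map x [0..<Suc n])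
        \<partial>distr (lborel \<Otimes>\<^sub>M lborel_tuple n) (lborel_tuple (Suc n)) ?c)" by simp
  also have "\<dots> = (\<integral>\<^sup>+p. g (map (?c p) [0..<Suc n]) \<partial>(lborel \<Otimes>\<^sub>M lborel_tuple n))"
    using g c by (subst nn_integral_distr) (auto simp: measurable_tuples_iff simp del: upt_Suc)
  also have "\<dots> = (\<integral>\<^sup>+p. g (case p of (\<tau>, x) \<Rightarrow> \<tau> # map x [0..<n]) \<partial>(lborel \<Otimes>\<^sub>M lborel_tuple n))"
    by (intro nn_integral_cong arg_cong[of _ _ g])
      (auto simp: upt_conv_Cons map_Suc_upt[symmetric] simp del: upt_Suc)
  also have "\<dots> = (\<integral>\<^sup>+\<tau>. (\<integral>\<^sup>+x. g (\<tau> # map x [0..<n]) \<partial>lborel_tuple n) \<partial>lborel)"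
    using measurable_compose[OF measurable_Cons_map_upt g]
    by (subst T.nn_integral_fst[symmetric]) auto
  finally show ?thesis .
qed

lemma nn_integral_lborel_tuple_Suc_back:
  assumes g: "g \<in> borel_measurable tuples"
  shows "(\<integral>\<^sup>+x. g (map x [0..<Suc n]) \<partial>lborel_tuple (Suc n))
    = (\<integral>\<^sup>+\<tau>. (\<integral>\<^sup>+x. g (map x [0..<n] @ [\<tau>]) \<partial>lborel_tuple n) \<partial>lborel)"
proof -
  have "(\<integral>\<^sup>+x. g (map x [0..<Suc n]) \<partial>lborel_tuple (Suc n))
    = (\<integral>\<^sup>+\<tau>. (\<integral>\<^sup>+x. g (map (x(n := \<tau>)) [0..<Suc n]) \<partial>lborel_tuple n) \<partial>lborel)"
    using g unfolding lessThan_Suc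
    by (intro lborel_tuple.product_nn_integral_insert_rev)
      (auto simp: measurable_tuples_iff lessThan_Suc[symmetric] simp del: upt_Suc)
  then show ?thesis by simp
qed

lemma nn_integral_tuples_split:
  assumes g: "g \<in> borel_measurable tuples"
    and c: "\<And>n. (\<lambda>(\<tau>, x). c \<tau> (map x [0..<n])) \<in> measurable (lborel \<Otimes>\<^sub>M lborel_tuple n) tuples"
    and Suc: "\<And>n. (\<integral>\<^sup>+x. g (map x [0..<Suc n]) \<partial>lborel_tuple (Suc n))
      = (\<integral>\<^sup>+\<tau>. (\<integral>\<^sup>+x. g (c \<tau> (map x [0..<n])) \<partial>lborel_tuple n) \<partial>lborel)"
  shows "(\<integral>\<^sup>+ts. g ts \<partial>tuples) = g [] + (\<integral>\<^sup>+\<tau>. (\<integral>\<^sup>+ts. g (c \<tau> ts) \<partial>tuples) \<partial>lborel)"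
proof -
  have gc: "(\<lambda>p. g (c (fst p) (map (snd p) [0..<n]))) \<in> borel_measurable (lborel \<Otimes>\<^sub>M lborel_tuple n)" for n
    using measurable_compose[OF c g] by (simp add: split_beta')
  have gc': "(\<lambda>ts. g (c \<tau> ts)) \<in> borel_measurable tuples" for \<tau>
    unfolding measurable_tuples_iff
  proof
    fix n
    show "(\<lambda>x. g (c \<tau> (map x [0..<n]))) \<in> borel_measurable (lborel_tuple n)"
      using measurable_compose[OF measurable_Pair1' gc, of \<tau> n] by simp
  qed
  have meas: "(\<lambda>\<tau>. \<integral>\<^sup>+x. g (c \<tau> (map x [0..<n])) \<partial>lborel_tuple n) \<in> borel_measurable lborel" for n
  proof -
    interpret T: finite_product_sigma_finite "\<lambda>_::nat. lborel :: real measure" "{..<n}"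
      by standard simp
    show ?thesis
      using gc by (intro T.borel_measurable_nn_integral) (simp add: split_beta')
  qed
  have "(\<integral>\<^sup>+ts. g ts \<partial>tuples) = (\<Sum>n. \<integral>\<^sup>+x. g (map x [0..<n]) \<partial>lborel_tuple n)"
    using g by (rule nn_integral_tuples)
  also have "\<dots> = (\<Sum>n. \<integral>\<^sup>+x. g (map x [0..<Suc n]) \<partial>lborel_tuple (Suc n)) + g []"
    by (subst suminf_offset[of _ 1]) (auto simp: space_PiM PiM_empty nn_integral_count_space_finite simp del: upt_Suc)
  also have "(\<Sum>n. \<integral>\<^sup>+x. g (map x [0..<Suc n]) \<partial>lborel_tuple (Suc n))
    = (\<integral>\<^sup>+\<tau>. (\<Sum>n. \<integral>\<^sup>+x. g (c \<tau> (map x [0..<n])) \<partial>lborel_tuple n) \<partial>lborel)"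
    unfolding Suc using meas by (subst nn_integral_suminf) auto
  also have "\<dots> = (\<integral>\<^sup>+\<tau>. (\<integral>\<^sup>+ts. g (c \<tau> ts) \<partial>tuples) \<partial>lborel)"
    using nn_integral_tuples[OF gc'] by simp
  finally show ?thesis by (simp add: add.commute)
qed

lemma nn_integral_tuples_Cons:
  assumes "g \<in> borel_measurable tuples"
  shows "(\<integral>\<^sup>+ts. g ts \<partial>tuples) = g [] + (\<integral>\<^sup>+\<tau>. (\<integral>\<^sup>+ts. g (\<tau> # ts) \<partial>tuples) \<partial>lborel)"
proof (rule nn_integral_tuples_split[where c = "(#)" and g = g, OF assms])
  fix n
  show "(\<lambda>(\<tau>, x). \<tau> # map x [0..<n]) \<in> measurable (lborel \<Otimes>\<^sub>M lborel_tuple n) tuples"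
    by (rule measurable_Cons_map_upt)
qed (rule nn_integral_lborel_tuple_Suc_front[OF assms])

lemma nn_integral_tuples_snoc:
  assumes "g \<in> borel_measurable tuples"
  shows "(\<integral>\<^sup>+ts. g ts \<partial>tuples) = g [] + (\<integral>\<^sup>+\<tau>. (\<integral>\<^sup>+ts. g (ts @ [\<tau>]) \<partial>tuples) \<partial>lborel)"
proof (rule nn_integral_tuples_split[where c = "\<lambda>\<tau> ts. ts @ [\<tau>]" and g = g, OF assms])
  fix n
  show "(\<lambda>(\<tau>, x). map x [0..<n] @ [\<tau>]) \<in> measurable (lborel \<Otimes>\<^sub>M lborel_tuple n) tuples"
    by (rule measurable_snoc_map_upt)
qed (rule nn_integral_lborel_tuple_Suc_back[OF assms])

lemma measurable_length_tuples [measurable]: "length \<in> measurable tuples (count_space UNIV)"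
  by (simp add: measurable_tuples_iff)

lemma measurable_nth_tuples [measurable]: "(\<lambda>ts. ts ! i) \<in> borel_measurable tuples"
  unfolding measurable_tuples_iff
proof
  fix n
  show "(\<lambda>x. map x [0..<n] ! i) \<in> borel_measurable (lborel_tuple n)"
  proof (cases "i < n")
    case False
    have "map x [0..<n] ! i = [] ! (i - n)" for x :: "nat \<Rightarrow> real"
      using False nth_append[of "map x [0..<n]" "[]" i] by simp
    then show ?thesis by simp
  qed simp
qed

lemma measurable_extend_tuples:
  assumes k: "k \<in> measurable N (count_space UNIV)"
    and h: "\<And>n i. i < n \<Longrightarrow> (\<lambda>x. h n x i) \<in> borel_measurable N"
  shows "(\<lambda>x. map (h (k x) x) [0..<k x]) \<in> measurable N tuples"
  using k by (intro measurable_compose_countable[where f = "\<lambda>n x. map (h n x) [0..<n]" and g = k])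
    (auto intro!: measurable_map_upt h)

lemma increasing_tuples_in_sets [measurable]: "increasing_tuples \<in> sets tuples"
proof -
  have "tuple_section increasing_tuples n
      = {x \<in> space (lborel_tuple n). \<forall>i\<in>{..<n}. \<forall>j\<in>{..<n}. i < j \<longrightarrow> x i < x j}" for n
    by (auto simp: tuple_section_def increasing_tuples_def sorted_wrt_iff_nth_less)
  moreover have "{x \<in> space (lborel_tuple n). \<forall>i\<in>{..<n}. \<forall>j\<in>{..<n}. i < j \<longrightarrow> x i < x j}
      \<in> sets (lborel_tuple n)" for n
  proof (intro sets.sets_Collect_finite_All sets.sets_Collect_imp)
    fix i j assume "i \<in> {..<n}" "j \<in> {..<n}"
    then show "{x \<in> space (lborel_tuple n). x i < x j} \<in> sets (lborel_tuple n)"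
      by measurable
  qed auto
  ultimately show ?thesis by (simp add: sets_tuples)
qed

lemma sigma_finite_tuples: "sigma_finite_measure tuples"
proof
  define A where "A n k = {ts. length ts = n \<and> (\<forall>i\<in>{..<n}. ts ! i \<in> {- real k .. real k})}" for n k
  have sets: "A n k \<in> sets tuples" for n k
  proof -
    have "{ts \<in> space tuples. length ts = n \<and> (\<forall>i\<in>{..<n}. ts ! i \<in> {- real k .. real k})} \<in> sets tuples"
      by measurable
    then show ?thesis by (simp add: A_def)
  qed
  have cover: "\<exists>n k. ts \<in> A n k" for ts
  proof -
    obtain k where k: "Max (insert 0 (abs ` set ts)) \<le> real k"
      using real_arch_simple by blast
    have "ts ! i \<in> {- real k .. real k}" if "i < length ts" for i
    proof -
      have "\<bar>ts ! i\<bar> \<le> Max (insert 0 (abs ` set ts))"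
        using that by (intro Max_ge) auto
      then have "\<bar>ts ! i\<bar> \<le> real k"
        using k by (rule order_trans)
      then show ?thesis unfolding atLeastAtMost_iff by linarith
    qed
    then have "ts \<in> A (length ts) k" by (simp add: A_def)
    then show ?thesis by blast
  qed
  have fin: "emeasure tuples (A n k) \<noteq> \<infinity>" for n k
  proof -
    define B where "B = Pi\<^sub>E {..<n} (\<lambda>_. {- real k .. real k})"
    have B: "emeasure (lborel_tuple n) B = (\<Prod>i<n. emeasure lborel {- real k .. real k})"
      unfolding B_def by (intro lborel_tuple.emeasure_PiM) simp_all
    have "tuple_section (A n k) m = (if m = n then B else {})" for m
    proof (cases "m = n")
      case True
      then show ?thesis
        unfolding tuple_section_def space_PiM A_def B_def
        by (simp add: set_eq_iff PiE_iff del: atLeastAtMost_iff) blast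
    qed (simp add: tuple_section_def A_def)
    then have "emeasure tuples (A n k) = (\<Sum>m. if m = n then emeasure (lborel_tuple n) B else 0)"
      unfolding emeasure_tuples[OF sets] by (intro suminf_cong) simp
    also have "\<dots> = emeasure (lborel_tuple n) B"
      by (subst suminf_finite[of "{n}"]) simp_all
    also have "\<dots> < \<infinity>"
      unfolding B by (simp add: power_less_top_ennreal)
    finally show ?thesis by simp
  qed
  show "\<exists>A. countable A \<and> A \<subseteq> sets tuples \<and> \<Union>A = space tuples \<and> (\<forall>a\<in>A. emeasure tuples a \<noteq> \<infinity>)"
  proof (intro exI[of _ "range (case_prod A)"] conjI ballI)
    show "\<Union>(range (case_prod A)) = space tuples"
      using cover by auto
  qed (use sets fin in auto)
qed

interpretation tuples: sigma_finite_measure tuples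
  by (rule sigma_finite_tuples)

interpretation lborel_tuples: pair_sigma_finite "lborel :: real measure" tuples ..

lemma measurable_cnj [measurable]: "cnj \<in> borel_measurable borel"
  by (intro borel_measurable_continuous_onI continuous_intros)

lemma square_integrable_iff_nn:
  "square_integrable M f \<longleftrightarrow> f \<in> borel_measurable M \<and> (\<integral>\<^sup>+x. ennreal ((cmod (f x))\<^sup>2) \<partial>M) < \<infinity>"
  by (auto simp: square_integrable_def integrable_iff_bounded)

lemma square_integrable_add:
  assumes "square_integrable M f" "square_integrable M g"
  shows "square_integrable M (\<lambda>x. f x + g x)"
  unfolding square_integrable_def
proof
  have *: "(cmod (f x + g x))\<^sup>2 \<le> 2 * (cmod (f x))\<^sup>2 + 2 * (cmod (g x))\<^sup>2" for x
  proof -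
    have "(cmod (f x + g x))\<^sup>2 \<le> (cmod (f x) + cmod (g x))\<^sup>2"
      by (intro power_mono norm_triangle_ineq) simp
    also have "\<dots> \<le> 2 * (cmod (f x))\<^sup>2 + 2 * (cmod (g x))\<^sup>2"
      using sum_squares_bound[of "cmod (f x)" "cmod (g x)"] by (simp add: power2_sum)
    finally show ?thesis .
  qed
  show "integrable M (\<lambda>x. (cmod (f x + g x))\<^sup>2)"
    by (rule Bochner_Integration.integrable_bound[of _ "\<lambda>x. 2 * (cmod (f x))\<^sup>2 + 2 * (cmod (g x))\<^sup>2"])
      (use assms * in \<open>auto simp: square_integrable_def\<close>)
qed (use assms in \<open>auto simp: square_integrable_def\<close>)

lemma measurable_inc_tuples_iff:
  fixes g :: "real list \<Rightarrow> complex"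
  shows "g \<in> borel_measurable inc_tuples \<longleftrightarrow> (\<lambda>ts. indicator increasing_tuples ts *\<^sub>R g ts) \<in> borel_measurable tuples"
  unfolding inc_tuples_def by (subst borel_measurable_restrict_space_iff) auto

lemma nn_integral_inc_tuples:
  "(\<integral>\<^sup>+ts. g ts \<partial>inc_tuples) = (\<integral>\<^sup>+ts. g ts * indicator increasing_tuples ts \<partial>tuples)"
  unfolding inc_tuples_def by (subst nn_integral_restrict_space) auto

lemma AE_inc_tuples_iff:
  "(AE ts in inc_tuples. P ts) \<longleftrightarrow> (AE ts in tuples. ts \<in> increasing_tuples \<longrightarrow> P ts)"
  unfolding inc_tuples_def by (subst AE_restrict_space_iff) auto

text \<open>Left and right creation and annihilation differ only in the end of a tuple at which a
  coordinate is attached.\<close>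

locale attach =
  fixes attach :: "real \<Rightarrow> real list \<Rightarrow> real list"
    and coord :: "real list \<Rightarrow> real" and rest :: "real list \<Rightarrow> real list"
  assumes measurable_attach:
      "(\<lambda>p. attach (fst p) (snd p)) \<in> measurable (lborel \<Otimes>\<^sub>M tuples) tuples"
    and measurable_coord [measurable]: "coord \<in> borel_measurable tuples"
    and measurable_rest [measurable]: "rest \<in> measurable tuples tuples"
    and coord_attach [simp]: "coord (attach \<tau> ts) = \<tau>"
    and rest_attach [simp]: "rest (attach \<tau> ts) = ts"
    and attach_neq_Nil [simp]: "attach \<tau> ts \<noteq> []"
    and attach_coord_rest: "ts \<noteq> [] \<Longrightarrow> attach (coord ts) (rest ts) = ts"
    and attach_increasing: "attach \<tau> ts \<in> increasing_tuples \<Longrightarrow> ts \<in> increasing_tuples"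
    and nn_integral_attach: "g \<in> borel_measurable tuples \<Longrightarrow>
      (\<integral>\<^sup>+ts. g ts \<partial>tuples) = g [] + (\<integral>\<^sup>+\<tau>. (\<integral>\<^sup>+ts. g (attach \<tau> ts) \<partial>tuples) \<partial>lborel)"
begin

definition "create f g ts = (if ts = [] then 0 else f (coord ts) * g (rest ts) :: complex)"

definition "annihilate f g ts
  = (LINT \<tau>:{\<tau>. attach \<tau> ts \<in> increasing_tuples}|lborel. cnj (f \<tau>) * (g (attach \<tau> ts) :: complex))"

lemma measurable_attach' [measurable (raw)]:
  assumes "k \<in> borel_measurable N" "l \<in> measurable N tuples"
  shows "(\<lambda>x. attach (k x) (l x)) \<in> measurable N tuples"
proof -
  have "(\<lambda>x. (k x, l x)) \<in> measurable N (lborel \<Otimes>\<^sub>M tuples)"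
    using assms by (intro measurable_Pair) simp_all
  from measurable_compose[OF this measurable_attach] show ?thesis by simp
qed

lemma Nil_measurable [measurable]: "Measurable.pred tuples (\<lambda>ts. ts = [])"
proof -
  have "Measurable.pred tuples (\<lambda>ts. length ts = 0)" by measurable
  then show ?thesis by simp
qed

lemma rest_increasing: "ts \<noteq> [] \<Longrightarrow> ts \<in> increasing_tuples \<Longrightarrow> rest ts \<in> increasing_tuples"
  using attach_increasing[of "coord ts" "rest ts"] attach_coord_rest[of ts] by simp

lemma square_integrable_create:
  assumes f: "square_integrable lborel f" and g: "square_integrable inc_tuples g"
  shows "square_integrable inc_tuples (create f g)"
proof -
  define G where "G ts = indicator increasing_tuples ts *\<^sub>R g ts" for ts
  have G [measurable]: "G \<in> borel_measurable tuples"
    using g by (simp add: square_integrable_def measurable_inc_tuples_iff G_def[abs_def])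
  have [measurable]: "f \<in> borel_measurable borel"
    using f by (simp add: square_integrable_def)
  have eq: "indicator increasing_tuples ts *\<^sub>R create f g ts = indicator increasing_tuples ts *\<^sub>R create f G ts" for ts
    using rest_increasing by (auto simp: create_def G_def indicator_def)
  have fG [measurable]: "create f G \<in> borel_measurable tuples"
    unfolding create_def[abs_def] by measurable
  have "(\<integral>\<^sup>+ts. ennreal ((cmod (create f g ts))\<^sup>2) \<partial>inc_tuples)
      = (\<integral>\<^sup>+ts. ennreal ((cmod (indicator increasing_tuples ts *\<^sub>R create f g ts))\<^sup>2) \<partial>tuples)"
    unfolding nn_integral_inc_tuples by (intro nn_integral_cong) (auto simp: indicator_def)
  also have "\<dots> \<le> (\<integral>\<^sup>+ts. ennreal ((cmod (create f G ts))\<^sup>2) \<partial>tuples)"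
    unfolding eq by (intro nn_integral_mono) (auto simp: indicator_def)
  also have "\<dots> = (\<integral>\<^sup>+\<tau>. (\<integral>\<^sup>+ts. ennreal ((cmod (f \<tau>))\<^sup>2) * ennreal ((cmod (G ts))\<^sup>2) \<partial>tuples) \<partial>lborel)"
    by (subst nn_integral_attach) (auto simp: create_def norm_mult power_mult_distrib ennreal_mult)
  also have "\<dots> = (\<integral>\<^sup>+\<tau>. ennreal ((cmod (f \<tau>))\<^sup>2) \<partial>lborel) * (\<integral>\<^sup>+ts. ennreal ((cmod (G ts))\<^sup>2) \<partial>tuples)"
    by (simp add: nn_integral_cmult nn_integral_multc)
  also have "(\<integral>\<^sup>+ts. ennreal ((cmod (G ts))\<^sup>2) \<partial>tuples) = (\<integral>\<^sup>+ts. ennreal ((cmod (g ts))\<^sup>2) \<partial>inc_tuples)"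
    unfolding nn_integral_inc_tuples G_def by (intro nn_integral_cong) (auto simp: indicator_def)
  also have "(\<integral>\<^sup>+\<tau>. ennreal ((cmod (f \<tau>))\<^sup>2) \<partial>lborel) * \<dots> < \<infinity>"
    using f g by (simp add: square_integrable_iff_nn ennreal_mult_less_top)
  finally show ?thesis
    by (simp add: square_integrable_iff_nn measurable_inc_tuples_iff eq)
qed

lemma AE_attach:
  assumes "AE ts in tuples. P ts"
  shows "AE ts in tuples. AE \<tau> in lborel. P (attach \<tau> ts)"
proof -
  obtain N where N: "{ts. \<not> P ts} \<subseteq> N" "N \<in> sets tuples" "emeasure tuples N = 0"
    using assms by (auto elim!: AE_E)
  have [measurable]: "N \<in> sets tuples" by fact
  have "0 = (\<integral>\<^sup>+ts. indicator N ts \<partial>tuples)" using N by simp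
  also have "\<dots> = indicator N [] + (\<integral>\<^sup>+\<tau>. (\<integral>\<^sup>+ts. indicator N (attach \<tau> ts) \<partial>tuples) \<partial>lborel)"
    by (rule nn_integral_attach) measurable
  also have "(\<integral>\<^sup>+\<tau>. (\<integral>\<^sup>+ts. indicator N (attach \<tau> ts) \<partial>tuples) \<partial>lborel)
      = (\<integral>\<^sup>+ts. (\<integral>\<^sup>+\<tau>. indicator N (attach \<tau> ts) \<partial>lborel) \<partial>tuples)"
    by (rule lborel_tuples.Fubini'[symmetric]) (simp add: split_beta')
  finally have 0: "(\<integral>\<^sup>+ts. (\<integral>\<^sup>+\<tau>. indicator N (attach \<tau> ts) \<partial>lborel) \<partial>tuples) = 0"
    by simp
  have "AE ts in tuples. (\<integral>\<^sup>+\<tau>. indicator N (attach \<tau> ts) \<partial>lborel) = 0"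
    using 0 by (subst (asm) nn_integral_0_iff_AE) measurable
  then show ?thesis
  proof eventually_elim
    case (elim ts)
    have "AE \<tau> in lborel. (indicator N (attach \<tau> ts) :: ennreal) = 0"
      using elim by (subst (asm) nn_integral_0_iff_AE) measurable
    then show ?case
    proof eventually_elim
      case (elim \<tau>)
      then show ?case using N(1) by (auto simp: indicator_def split: if_splits)
    qed
  qed
qed

lemma AE_rest:
  assumes "AE ts in tuples. P ts"
  shows "AE ts in tuples. ts \<noteq> [] \<longrightarrow> P (rest ts)"
proof -
  obtain N where N: "{ts. \<not> P ts} \<subseteq> N" "N \<in> sets tuples" "emeasure tuples N = 0"
    using assms by (auto elim!: AE_E)
  have [measurable]: "N \<in> sets tuples" by fact
  have "(\<integral>\<^sup>+ts. (if ts = [] then 0 else indicator N (rest ts)) \<partial>tuples) = (0::ennreal)"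
    using N by (subst nn_integral_attach) simp_all
  then have "AE ts in tuples. (if ts = [] then 0 else indicator N (rest ts)) = (0::ennreal)"
    by (subst (asm) nn_integral_0_iff_AE) measurable
  then show ?thesis
  proof eventually_elim
    case (elim ts)
    then show ?case using N(1) by (auto simp: indicator_def split: if_splits)
  qed
qed

lemma AE_create:
  assumes "AE ts in inc_tuples. g ts = h ts"
  shows "AE ts in inc_tuples. create f g ts = create f h ts"
  using AE_rest[OF assms[unfolded AE_inc_tuples_iff]] unfolding AE_inc_tuples_iff
  by eventually_elim (auto simp: create_def rest_increasing)

lemma AE_annihilate:
  assumes g: "square_integrable inc_tuples g" and h: "square_integrable inc_tuples h"
    and f: "square_integrable lborel f"
    and eq: "AE ts in inc_tuples. g ts = h ts"
  shows "AE ts in inc_tuples. annihilate f g ts = annihilate f h ts"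
proof -
  have m: "(\<lambda>\<tau>. indicator {\<tau>. attach \<tau> ts \<in> increasing_tuples} \<tau> *\<^sub>R (cnj (f \<tau>) * g (attach \<tau> ts))) \<in> borel_measurable lborel"
    if "square_integrable inc_tuples g" for g ts
  proof -
    have [measurable]: "f \<in> borel_measurable borel"
      "(\<lambda>ts. indicator increasing_tuples ts *\<^sub>R g ts) \<in> borel_measurable tuples"
      using f that by (simp_all add: square_integrable_def measurable_inc_tuples_iff)
    have "(\<lambda>\<tau>. cnj (f \<tau>) * (indicator increasing_tuples (attach \<tau> ts) *\<^sub>R g (attach \<tau> ts))) \<in> borel_measurable lborel"
      by measurable
    then show ?thesis by (simp add: indicator_def)
  qed
  have "AE ts in tuples. annihilate f g ts = annihilate f h ts"
    using AE_attach[OF eq[unfolded AE_inc_tuples_iff]]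
  proof eventually_elim
    case (elim ts)
    have "AE \<tau> in lborel. indicator {\<tau>. attach \<tau> ts \<in> increasing_tuples} \<tau> *\<^sub>R (cnj (f \<tau>) * g (attach \<tau> ts))
        = indicator {\<tau>. attach \<tau> ts \<in> increasing_tuples} \<tau> *\<^sub>R (cnj (f \<tau>) * h (attach \<tau> ts))"
      using elim by eventually_elim (auto simp: indicator_def)
    then show ?case
      unfolding annihilate_def set_lebesgue_integral_def
      by (intro integral_cong_AE m g h)
  qed
  then show ?thesis unfolding AE_inc_tuples_iff by eventually_elim simp
qed

lemma square_integrable_annihilate:
  assumes f: "square_integrable lborel f" and g: "square_integrable inc_tuples g"
  shows "square_integrable inc_tuples (annihilate f g)"
proof -
  define G where "G ts = indicator increasing_tuples ts *\<^sub>R g ts" for ts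
  have G [measurable]: "G \<in> borel_measurable tuples"
    using g by (simp add: square_integrable_def measurable_inc_tuples_iff G_def[abs_def])
  have [measurable]: "f \<in> borel_measurable borel"
    using f by (simp add: square_integrable_def)
  have eq: "annihilate f g = (\<lambda>ts. LINT \<tau>|lborel. cnj (f \<tau>) * G (attach \<tau> ts))"
    unfolding annihilate_def[abs_def] set_lebesgue_integral_def
    by (intro ext Bochner_Integration.integral_cong) (auto simp: G_def indicator_def)
  have [measurable]: "annihilate f g \<in> borel_measurable tuples"
  proof -
    have "(\<lambda>(ts, \<tau>). cnj (f \<tau>) * G (attach \<tau> ts)) \<in> borel_measurable (tuples \<Otimes>\<^sub>M lborel)"
      by measurable
    then show ?thesis unfolding eq by (rule lborel.borel_measurable_lebesgue_integral)
  qed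
  have CS: "ennreal ((cmod (annihilate f g ts))\<^sup>2)
      \<le> (\<integral>\<^sup>+\<tau>. ennreal ((cmod (f \<tau>))\<^sup>2) \<partial>lborel) * (\<integral>\<^sup>+\<tau>. ennreal ((cmod (G (attach \<tau> ts)))\<^sup>2) \<partial>lborel)" for ts
  proof -
    have "ennreal (cmod (annihilate f g ts)) \<le> (\<integral>\<^sup>+\<tau>. ennreal (cmod (cnj (f \<tau>) * G (attach \<tau> ts))) \<partial>lborel)"
      unfolding eq
      by (cases "integrable lborel (\<lambda>\<tau>. cnj (f \<tau>) * G (attach \<tau> ts))")
        (auto simp: not_integrable_integral_eq intro: integral_norm_bound_ennreal)
    then have "ennreal (cmod (annihilate f g ts))
        \<le> (\<integral>\<^sup>+\<tau>. ennreal (cmod (f \<tau>)) * ennreal (cmod (G (attach \<tau> ts))) \<partial>lborel)"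
      by (simp add: norm_mult ennreal_mult)
    then have "(ennreal (cmod (annihilate f g ts)))\<^sup>2
        \<le> (\<integral>\<^sup>+\<tau>. ennreal (cmod (f \<tau>)) * ennreal (cmod (G (attach \<tau> ts))) \<partial>lborel)\<^sup>2"
      by (intro power_mono) auto
    also have "\<dots> \<le> (\<integral>\<^sup>+\<tau>. ennreal (cmod (f \<tau>)) ^ 2 \<partial>lborel) * (\<integral>\<^sup>+\<tau>. ennreal (cmod (G (attach \<tau> ts))) ^ 2 \<partial>lborel)"
      by (rule Cauchy_Schwarz_nn_integral) measurable
    finally show ?thesis by (simp add: ennreal_power)
  qed
  have "(\<integral>\<^sup>+ts. ennreal ((cmod (annihilate f g ts))\<^sup>2) \<partial>inc_tuples)
      \<le> (\<integral>\<^sup>+ts. ennreal ((cmod (annihilate f g ts))\<^sup>2) \<partial>tuples)"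
    unfolding nn_integral_inc_tuples by (intro nn_integral_mono) (auto simp: indicator_def)
  also have "\<dots> \<le> (\<integral>\<^sup>+ts. (\<integral>\<^sup>+\<tau>. ennreal ((cmod (f \<tau>))\<^sup>2) \<partial>lborel)
      * (\<integral>\<^sup>+\<tau>. ennreal ((cmod (G (attach \<tau> ts)))\<^sup>2) \<partial>lborel) \<partial>tuples)"
    by (intro nn_integral_mono CS)
  also have "\<dots> = (\<integral>\<^sup>+\<tau>. ennreal ((cmod (f \<tau>))\<^sup>2) \<partial>lborel)
      * (\<integral>\<^sup>+ts. (\<integral>\<^sup>+\<tau>. ennreal ((cmod (G (attach \<tau> ts)))\<^sup>2) \<partial>lborel) \<partial>tuples)"
    by (rule nn_integral_cmult) measurable
  also have "(\<integral>\<^sup>+ts. (\<integral>\<^sup>+\<tau>. ennreal ((cmod (G (attach \<tau> ts)))\<^sup>2) \<partial>lborel) \<partial>tuples)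
      = (\<integral>\<^sup>+\<tau>. (\<integral>\<^sup>+ts. ennreal ((cmod (G (attach \<tau> ts)))\<^sup>2) \<partial>tuples) \<partial>lborel)"
    by (rule lborel_tuples.Fubini') (simp add: split_beta')
  also have "\<dots> \<le> (\<integral>\<^sup>+ts. ennreal ((cmod (G ts))\<^sup>2) \<partial>tuples)"
    by (subst (2) nn_integral_attach) auto
  also have "\<dots> = (\<integral>\<^sup>+ts. ennreal ((cmod (g ts))\<^sup>2) \<partial>inc_tuples)"
    unfolding nn_integral_inc_tuples G_def by (intro nn_integral_cong) (auto simp: indicator_def)
  finally have "(\<integral>\<^sup>+ts. ennreal ((cmod (annihilate f g ts))\<^sup>2) \<partial>inc_tuples)
      \<le> (\<integral>\<^sup>+\<tau>. ennreal ((cmod (f \<tau>))\<^sup>2) \<partial>lborel) * (\<integral>\<^sup>+ts. ennreal ((cmod (g ts))\<^sup>2) \<partial>inc_tuples)"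
    by (simp add: mult_left_mono)
  also have "\<dots> < \<infinity>"
    using f g by (simp add: square_integrable_iff_nn ennreal_mult_less_top)
  finally show ?thesis
    by (simp add: square_integrable_iff_nn measurable_inc_tuples_iff)
qed

end

lemma measurable_hd_tuples: "hd \<in> borel_measurable tuples"
  unfolding measurable_tuples_iff
proof
  fix n
  show "(\<lambda>x. hd (map x [0..<n])) \<in> borel_measurable (lborel_tuple n)"
    by (cases n) (simp_all add: hd_map del: upt_Suc)
qed

lemma measurable_last_tuples: "last \<in> borel_measurable tuples"
  unfolding measurable_tuples_iff
proof
  fix n
  show "(\<lambda>x. last (map x [0..<n])) \<in> borel_measurable (lborel_tuple n)"
    by (cases n) simp_all
qed

lemma measurable_tl_tuples: "tl \<in> measurable tuples tuples"
proof -
  have "(\<lambda>ts. map (\<lambda>i. ts ! Suc i) [0..<length ts - 1]) \<in> measurable tuples tuples"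
    by (rule measurable_extend_tuples) auto
  moreover have "map (\<lambda>i. ts ! Suc i) [0..<length ts - 1] = tl ts" for ts :: "real list"
    by (rule nth_equalityI) (simp_all add: nth_tl)
  ultimately show ?thesis by simp
qed

lemma measurable_butlast_tuples: "butlast \<in> measurable tuples tuples"
proof -
  have "(\<lambda>ts. map (\<lambda>i. ts ! i) [0..<length ts - 1]) \<in> measurable tuples tuples"
    by (rule measurable_extend_tuples) auto
  moreover have "map (\<lambda>i. ts ! i) [0..<length ts - 1] = butlast ts" for ts :: "real list"
    by (rule nth_equalityI) (simp_all add: nth_butlast)
  ultimately show ?thesis by simp
qed

interpretation left: attach "(#)" hd tl
proof
  show "(\<lambda>p. fst p # snd p) \<in> measurable (lborel \<Otimes>\<^sub>M tuples) tuples"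
  proof -
    have "(\<lambda>p. map (case_nat (fst p) (nth (snd p))) [0..<Suc (length (snd p))])
        \<in> measurable (lborel \<Otimes>\<^sub>M tuples) tuples"
      by (rule measurable_extend_tuples) (auto split: nat.split)
    moreover have "map (case_nat \<tau> (nth ts)) [0..<Suc (length ts)] = \<tau> # ts" for \<tau> :: real and ts
      by (rule nth_equalityI) (auto split: nat.split simp del: upt_Suc)
    ultimately show ?thesis by simp
  qed
qed (auto simp: measurable_hd_tuples measurable_tl_tuples increasing_tuples_def nn_integral_tuples_Cons)

interpretation right: attach "\<lambda>\<tau> ts. ts @ [\<tau>]" last butlast
proof
  show "(\<lambda>p. snd p @ [fst p]) \<in> measurable (lborel \<Otimes>\<^sub>M tuples) tuples"
  proof -
    have "(\<lambda>p. map (\<lambda>i. if i < length (snd p) then snd p ! i else fst p) [0..<Suc (length (snd p))])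
        \<in> measurable (lborel \<Otimes>\<^sub>M tuples) tuples"
      by (rule measurable_extend_tuples[where k = "\<lambda>p. Suc (length (snd p))"
            and h = "\<lambda>n p i. if i < length (snd p) then snd p ! i else fst p"]) measurable
    moreover have "map (\<lambda>i. if i < length ts then ts ! i else \<tau>) [0..<Suc (length ts)] = ts @ [\<tau>]"
      for \<tau> :: real and ts
      by (rule nth_equalityI) (auto simp: nth_append simp del: upt_Suc)
    ultimately show ?thesis by simp
  qed
qed (auto simp: measurable_last_tuples measurable_butlast_tuples increasing_tuples_def sorted_wrt_append
    nn_integral_tuples_snoc)


subsection \<open>The space and its operators\<close>

definition fock_rel :: "(real list \<Rightarrow> complex) \<Rightarrow> (real list \<Rightarrow> complex) \<Rightarrow> bool" where
  "fock_rel g h \<longleftrightarrow> square_integrable inc_tuples g \<and> square_integrable inc_tuples h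
    \<and> (AE ts in inc_tuples. g ts = h ts)"

lemma fock_rel_cong:
  assumes "\<And>ts. ts \<in> increasing_tuples \<Longrightarrow> g ts = g' ts"
    and "\<And>ts. ts \<in> increasing_tuples \<Longrightarrow> h ts = h' ts"
  shows "fock_rel g h \<longleftrightarrow> fock_rel g' h'"
proof -
  have cong: "square_integrable inc_tuples f \<longleftrightarrow> square_integrable inc_tuples f'"
    if eq: "\<And>ts. ts \<in> increasing_tuples \<Longrightarrow> f ts = f' ts" for f f' :: "real list \<Rightarrow> complex"
  proof -
    have eq': "f ts = f' ts" if "ts \<in> space inc_tuples" for ts
      using that eq by (simp add: inc_tuples_def space_restrict_space)
    show ?thesis
      unfolding square_integrable_def
      by (intro arg_cong2[where f = "(\<and>)"] measurable_cong Bochner_Integration.integrable_cong)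
        (simp_all add: eq')
  qed
  have "square_integrable inc_tuples g \<longleftrightarrow> square_integrable inc_tuples g'"
    by (rule cong) (rule assms)
  moreover have "square_integrable inc_tuples h \<longleftrightarrow> square_integrable inc_tuples h'"
    by (rule cong) (rule assms)
  moreover have "(AE ts in inc_tuples. g ts = h ts) \<longleftrightarrow> (AE ts in inc_tuples. g' ts = h' ts)"
    unfolding AE_inc_tuples_iff using assms by (intro AE_cong) auto
  ultimately show ?thesis
    by (simp only: fock_rel_def)
qed

lemma fock_rel_zero: "fock_rel (\<lambda>_. 0) (\<lambda>_. 0)"
  by (simp add: fock_rel_def square_integrable_def)

context attach
begin

lemma fock_rel_create:
  "fock_rel g h \<Longrightarrow> square_integrable lborel f \<Longrightarrow> fock_rel (create f g) (create f h)"
  by (simp add: fock_rel_def square_integrable_create AE_create)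

lemma fock_rel_annihilate:
  "fock_rel g h \<Longrightarrow> square_integrable lborel f \<Longrightarrow> fock_rel (annihilate f g) (annihilate f h)"
  by (simp add: fock_rel_def square_integrable_annihilate AE_annihilate)

end

quotient_type fock = "real list \<Rightarrow> complex" / partial: fock_rel
proof (rule part_equivpI)
  show "\<exists>g. fock_rel g g"
    using fock_rel_zero by blast
  show "symp fock_rel"
    by (auto simp: symp_def fock_rel_def elim: eventually_mono)
  show "transp fock_rel"
  proof (rule transpI)
    fix f g h assume fg: "fock_rel f g" and gh: "fock_rel g h"
    have "AE ts in inc_tuples. f ts = g ts" "AE ts in inc_tuples. g ts = h ts"
      using fg gh by (simp_all add: fock_rel_def)
    then have "AE ts in inc_tuples. f ts = h ts" by eventually_elim simp
    then show "fock_rel f h" using fg gh by (simp add: fock_rel_def)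
  qed
qed

instantiation fock :: plus
begin

lift_definition plus_fock :: "fock \<Rightarrow> fock \<Rightarrow> fock" is "\<lambda>g h ts. g ts + h ts"
proof -
  fix g g' h h' assume g: "fock_rel g g'" and h: "fock_rel h h'"
  have "AE ts in inc_tuples. g ts = g' ts" "AE ts in inc_tuples. h ts = h' ts"
    using g h by (simp_all add: fock_rel_def)
  then have "AE ts in inc_tuples. g ts + h ts = g' ts + h' ts"
    by eventually_elim simp
  then show "fock_rel (\<lambda>ts. g ts + h ts) (\<lambda>ts. g' ts + h' ts)"
    using g h by (simp add: fock_rel_def square_integrable_add)
qed

instance ..

end

lift_definition fock_inner :: "fock \<Rightarrow> fock \<Rightarrow> complex" is
  "\<lambda>g h. LINT ts|inc_tuples. cnj (g ts) * h ts"
proof -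
  fix g g' h h' assume g: "fock_rel g g'" and h: "fock_rel h h'"
  have "AE ts in inc_tuples. g ts = g' ts" "AE ts in inc_tuples. h ts = h' ts"
    using g h by (simp_all add: fock_rel_def)
  then have "AE ts in inc_tuples. cnj (g ts) * h ts = cnj (g' ts) * h' ts"
    by eventually_elim simp
  moreover have [measurable]: "g \<in> borel_measurable inc_tuples" "g' \<in> borel_measurable inc_tuples"
    "h \<in> borel_measurable inc_tuples" "h' \<in> borel_measurable inc_tuples"
    using g h by (auto simp: fock_rel_def square_integrable_def)
  ultimately show "(LINT ts|inc_tuples. cnj (g ts) * h ts) = (LINT ts|inc_tuples. cnj (g' ts) * h' ts)"
    by (intro integral_cong_AE) measurable
qed

lift_definition vacuum :: fock is "\<lambda>ts. if ts = [] then 1 else 0"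
proof -
  have "(\<lambda>ts::real list. if ts = [] then 1 else 0 :: complex) \<in> borel_measurable tuples"
    using left.Nil_measurable by measurable
  then have 1: "(\<lambda>ts. if ts = [] then 1 else 0 :: complex) \<in> borel_measurable inc_tuples"
    unfolding inc_tuples_def by (rule measurable_restrict_space1)
  have "(\<integral>\<^sup>+ts. ennreal ((cmod (if ts = [] then 1 else 0))\<^sup>2) \<partial>inc_tuples)
      \<le> (\<integral>\<^sup>+ts. (if ts = [] then 1 else 0) \<partial>tuples)"
    unfolding nn_integral_inc_tuples by (intro nn_integral_mono) (auto simp: indicator_def)
  also have "\<dots> = 1"
    using left.Nil_measurable by (subst nn_integral_tuples_Cons) auto
  finally have "(\<integral>\<^sup>+ts. ennreal ((cmod (if ts = [] then 1 else 0))\<^sup>2) \<partial>inc_tuples) < \<infinity>"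
    by (rule le_less_trans) simp
  with 1 show "fock_rel (\<lambda>ts. if ts = [] then 1 else 0) (\<lambda>ts. if ts = [] then 1 else 0)"
    by (simp add: fock_rel_def square_integrable_iff_nn)
qed

text \<open>The argument of the creation and annihilation operators represents an element of
  \<open>L\<^sup>2(\<real>)\<close>; for other functions the operators are set to zero. At the empty tuple the
  annihilation operators integrate over the whole line.\<close>

lift_definition left_creation :: "(real \<Rightarrow> complex) \<Rightarrow> fock \<Rightarrow> fock" is
  "\<lambda>f g ts. if square_integrable lborel f
    then if ts = [] then 0 else f (hd ts) * g (tl ts)
    else 0"
proof -
  fix f g h assume gh: "fock_rel g h"
  show "?thesis f g h"
  proof (cases "square_integrable lborel f")
    case True
    show ?thesis
      using left.fock_rel_create[OF gh True] unfolding left.create_def[abs_def]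
      by (simp only: True if_True)
  qed (simp add: fock_rel_zero)
qed

lift_definition right_creation :: "(real \<Rightarrow> complex) \<Rightarrow> fock \<Rightarrow> fock" is
  "\<lambda>f g ts. if square_integrable lborel f
    then if ts = [] then 0 else g (butlast ts) * f (last ts)
    else 0"
proof -
  fix f g h assume gh: "fock_rel g h"
  show "?thesis f g h"
  proof (cases "square_integrable lborel f")
    case True
    show ?thesis
      using right.fock_rel_create[OF gh True] unfolding right.create_def[abs_def]
      by (simp only: True if_True mult.commute[of "f _"])
  qed (simp add: fock_rel_zero)
qed

lift_definition left_annihilation :: "(real \<Rightarrow> complex) \<Rightarrow> fock \<Rightarrow> fock" is
  "\<lambda>f g ts. if square_integrable lborel f
    then LINT \<tau>:{\<tau>. ts \<noteq> [] \<longrightarrow> \<tau> < hd ts}|lborel. cnj (f \<tau>) * g (\<tau> # ts)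
    else 0"
proof -
  fix f g h assume gh: "fock_rel g h"
  have iff: "\<tau> # ts \<in> increasing_tuples \<longleftrightarrow> (ts \<noteq> [] \<longrightarrow> \<tau> < hd ts)" if "ts \<in> increasing_tuples" for \<tau> ts
  proof (cases ts)
    case (Cons t us)
    have "\<forall>x\<in>set us. t < x"
      using that Cons by (simp add: increasing_tuples_def)
    then have lt: "\<tau> < t \<Longrightarrow> \<forall>x\<in>set us. \<tau> < x"
      using less_trans[of \<tau> t] by blast
    have "\<tau> # t # us \<in> increasing_tuples
        \<longleftrightarrow> \<tau> < t \<and> (\<forall>x\<in>set us. \<tau> < x) \<and> t # us \<in> increasing_tuples"
      unfolding increasing_tuples_def by simp
    then show ?thesis
      using that lt unfolding Cons by (simp only: list.sel list.distinct) blast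
  qed (simp add: increasing_tuples_def)
  have set: "{\<tau>. \<tau> # ts \<in> increasing_tuples} = {\<tau>. ts \<noteq> [] \<longrightarrow> \<tau> < hd ts}"
    if "ts \<in> increasing_tuples" for ts
    by (simp only: iff[OF that])
  have eq: "left.annihilate f g ts = (LINT \<tau>:{\<tau>. ts \<noteq> [] \<longrightarrow> \<tau> < hd ts}|lborel. cnj (f \<tau>) * g (\<tau> # ts))"
    if "ts \<in> increasing_tuples" for g ts
    unfolding left.annihilate_def set[OF that] ..
  show "?thesis f g h"
  proof (cases "square_integrable lborel f")
    case True
    have "fock_rel (left.annihilate f g) (left.annihilate f h) \<longleftrightarrow> fock_rel
        (\<lambda>ts. LINT \<tau>:{\<tau>. ts \<noteq> [] \<longrightarrow> \<tau> < hd ts}|lborel. cnj (f \<tau>) * g (\<tau> # ts))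
        (\<lambda>ts. LINT \<tau>:{\<tau>. ts \<noteq> [] \<longrightarrow> \<tau> < hd ts}|lborel. cnj (f \<tau>) * h (\<tau> # ts))"
      by (intro fock_rel_cong eq)
    from this[THEN iffD1, OF left.fock_rel_annihilate[OF gh True]] show ?thesis
      by (simp only: True if_True)
  qed (simp add: fock_rel_zero)
qed

lift_definition right_annihilation :: "(real \<Rightarrow> complex) \<Rightarrow> fock \<Rightarrow> fock" is
  "\<lambda>f g ts. if square_integrable lborel f
    then LINT \<tau>:{\<tau>. ts \<noteq> [] \<longrightarrow> last ts < \<tau>}|lborel. cnj (f \<tau>) * g (ts @ [\<tau>])
    else 0"
proof -
  fix f g h assume gh: "fock_rel g h"
  have iff: "ts @ [\<tau>] \<in> increasing_tuples \<longleftrightarrow> (ts \<noteq> [] \<longrightarrow> last ts < \<tau>)" if "ts \<in> increasing_tuples" for \<tau> ts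
  proof (cases ts rule: rev_cases)
    case (snoc us t)
    have "\<forall>x\<in>set us. x < t"
      using that snoc by (simp add: increasing_tuples_def sorted_wrt_append)
    then have lt: "t < \<tau> \<Longrightarrow> \<forall>x\<in>set us. x < \<tau>"
      using less_trans[of _ t \<tau>] by blast
    have "us @ [t] @ [\<tau>] \<in> increasing_tuples
        \<longleftrightarrow> us @ [t] \<in> increasing_tuples \<and> t < \<tau> \<and> (\<forall>x\<in>set us. x < \<tau>)"
      unfolding increasing_tuples_def by (simp add: sorted_wrt_append) blast
    then show ?thesis
      using that lt unfolding snoc by (simp only: append_assoc last_snoc) blast
  qed (simp add: increasing_tuples_def)
  have set: "{\<tau>. ts @ [\<tau>] \<in> increasing_tuples} = {\<tau>. ts \<noteq> [] \<longrightarrow> last ts < \<tau>}"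
    if "ts \<in> increasing_tuples" for ts
    by (simp only: iff[OF that])
  have eq: "right.annihilate f g ts = (LINT \<tau>:{\<tau>. ts \<noteq> [] \<longrightarrow> last ts < \<tau>}|lborel. cnj (f \<tau>) * g (ts @ [\<tau>]))"
    if "ts \<in> increasing_tuples" for g ts
    unfolding right.annihilate_def set[OF that] ..
  show "?thesis f g h"
  proof (cases "square_integrable lborel f")
    case True
    have "fock_rel (right.annihilate f g) (right.annihilate f h) \<longleftrightarrow> fock_rel
        (\<lambda>ts. LINT \<tau>:{\<tau>. ts \<noteq> [] \<longrightarrow> last ts < \<tau>}|lborel. cnj (f \<tau>) * g (ts @ [\<tau>]))
        (\<lambda>ts. LINT \<tau>:{\<tau>. ts \<noteq> [] \<longrightarrow> last ts < \<tau>}|lborel. cnj (f \<tau>) * h (ts @ [\<tau>]))"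
      by (intro fock_rel_cong eq)
    from this[THEN iffD1, OF right.fock_rel_annihilate[OF gh True]] show ?thesis
      by (simp only: True if_True)
  qed (simp add: fock_rel_zero)
qed

datatype face = Left_Face | Right_Face

definition field_operator :: "real \<Rightarrow> real \<Rightarrow> face \<Rightarrow> fock \<Rightarrow> fock" where
  "field_operator s t d g = (case d of
      Left_Face \<Rightarrow> left_creation (indicator {s..t}) g + left_annihilation (indicator {s..t}) g
    | Right_Face \<Rightarrow> right_creation (indicator {s..t}) g + right_annihilation (indicator {s..t}) g)"

definition operator_product :: "(fock \<Rightarrow> fock) list \<Rightarrow> fock \<Rightarrow> fock" where
  "operator_product bs = foldr (\<circ>) bs id"


section \<open>Bi-monotone pair partitions\<close>

text \<open>An ordered partition consists of the set \<open>P\<close> of its blocks and a total order \<open>r\<close> on \<open>P\<close>,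
  where \<open>(V, W) \<in> r\<close> means \<open>V \<le> W\<close>.\<close>

definition ordered_partition_on :: "'a set \<Rightarrow> 'a set set \<Rightarrow> 'a set rel \<Rightarrow> bool" where
  "ordered_partition_on X P r \<longleftrightarrow> partition_on X P \<and> linear_order_on P r"

definition bi_monotone :: "('a::linorder \<Rightarrow> face) \<Rightarrow> 'a set set \<Rightarrow> 'a set rel \<Rightarrow> bool" where
  "bi_monotone \<delta> P r \<longleftrightarrow>
    (\<forall>V\<in>P. \<forall>W\<in>P. \<forall>a\<in>V. \<forall>c\<in>V. \<forall>b\<in>W. a < b \<and> b < c \<longrightarrow>
      (case \<delta> b of Right_Face \<Rightarrow> (W, V) \<in> r | Left_Face \<Rightarrow> (V, W) \<in> r))"

text \<open>Patterns on \<open>{1..m}\<close> are lists of length \<open>m\<close>.\<close>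

definition bi_monotone_pair_partitions :: "face list \<Rightarrow> (nat set set \<times> nat set rel) set" where
  "bi_monotone_pair_partitions \<delta> =
    {(P, r). ordered_partition_on {1..length \<delta>} P r \<and> (\<forall>V\<in>P. card V = 2)
      \<and> bi_monotone (\<lambda>i. \<delta> ! (i - 1)) P r}"

end

theory Submission
  imports Defs
begin

text \<open>
  Apply the operators \<open>b\<close> to the vacuum one after the other, from the right end of the pattern to the
  left. Each one creates a particle with a time in \<open>[0, 1]\<close> or annihilates one by integrating over its
  time. The particles present always have increasing times, and the left face acts on the first of
  them, the right face on the last. Pairing each creation with the annihilation of the same particle
  and recording the relative order of all particle times, dead or alive, turns every term of the
  expanded product into a list of blocks, sorted by the time of their particles (\<open>configs\<close>). At any
  stage the vector is the sum over these lists of an explicit function of the live times: the volume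
  of the set of admissible times of the dead particles, which is a product of simplex volumes, one
  for each gap left by the live times in \<open>[0, 1]\<close> (\<open>density\<close>).

  That this form is preserved is the heart of the proof. Creating a particle cuts the outermost gap in
  two, and the binomial theorem for divided powers distributes the dead particles of the gap
  (\<open>density_create_left\<close>). Annihilating one merges two gaps, and the Beta integral counts the
  annihilated particle as a further dead one (\<open>density_annihilate_left\<close>). Reflection of time gives the
  right face. On the combinatorial side the same moves generate all lists of blocks on one more
  position (\<open>sum_configs_insert\<close>), and both combine in \<open>field_step_config_vector\<close>.

  At the end, the scalar product with the vacuum evaluates at the empty tuple, where only lists
  without live particles contribute, each with the volume \<open>1 / n!\<close> of the simplex of its \<open>n\<close> times. Such
  a list is a pair partition with a totally ordered set of blocks, and the requirement that every
  operator acts at the correct end is bi-monotonicity with respect to decreasing time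
  (\<open>card_bi_monotone_pair_partitions\<close>). For odd length there is no pair partition.
\<close>

section \<open>Divided powers\<close>

text \<open>The volume of a simplex: for \<open>x \<ge> 0\<close> this is the measure of the increasing \<open>n\<close>-tuples
  in an interval of length \<open>x\<close>.\<close>

definition divided_power :: "nat \<Rightarrow> real \<Rightarrow> real" where
  "divided_power n x = x ^ n / fact n"

lemma divided_power_0 [simp]: "divided_power 0 x = 1"
  by (simp add: divided_power_def)

lemma divided_power_Suc_at_0 [simp]: "divided_power (Suc n) 0 = 0"
  by (simp add: divided_power_def)

lemma continuous_on_divided_power [continuous_intros]:
  "continuous_on S f \<Longrightarrow> continuous_on S (\<lambda>x. divided_power n (f x))"
  unfolding divided_power_def by (intro continuous_intros) simp_all

lemma has_real_derivative_divided_power: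
  assumes "(f has_real_derivative f') (at x within S)"
  shows "((\<lambda>x. divided_power (Suc n) (f x)) has_real_derivative divided_power n (f x) * f')
    (at x within S)"
proof -
  have "((\<lambda>x. f x ^ Suc n / fact (Suc n)) has_real_derivative
      (of_nat (Suc n) * (f' * f x ^ (Suc n - Suc 0))) / fact (Suc n)) (at x within S)"
    using assms by (intro DERIV_cdivide DERIV_power)
  then show ?thesis
    unfolding divided_power_def by (rule DERIV_cong) (simp add: divide_simps del: of_nat_Suc)
qed

text \<open>The \<open>n\<close> points in an interval that is cut in two split into the \<open>k\<close> points
  to the left and the \<open>n - k\<close> points to the right of the cut.\<close>

lemma divided_power_add:
  "divided_power n (x + y) = (\<Sum>k\<le>n. divided_power k x * divided_power (n - k) y)"
proof -
  have "real (n choose k) / fact n = 1 / (fact k * fact (n - k))" if "k \<le> n" for k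
    using that by (simp add: binomial_fact field_simps)
  then show ?thesis
    unfolding divided_power_def binomial_ring sum_divide_distrib
    by (intro sum.cong) (simp_all add: field_simps)
qed

text \<open>The Beta integral at integer arguments: a point \<open>\<tau>\<close> with \<open>k\<close> points below and \<open>l\<close> points
  above it is integrated out and becomes one of \<open>k + l + 1\<close> points. Integration by parts trades
  one power of the first factor for one of the second, and the boundary terms vanish.\<close>

lemma divided_power_convolution:
  assumes "a \<le> e"
  shows "((\<lambda>\<tau>. divided_power k (\<tau> - a) * divided_power l (e - \<tau>)) has_integral
    divided_power (Suc (k + l)) (e - a)) {a..e}"
proof (induction k arbitrary: l)
  case 0
  have "((\<lambda>\<tau>. divided_power l (e - \<tau>)) has_integral
      (- divided_power (Suc l) (e - e)) - (- divided_power (Suc l) (e - a))) {a..e}"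
    using assms
    by (intro fundamental_theorem_of_calculus)
      (auto simp: has_real_derivative_iff_has_vector_derivative[symmetric]
        intro!: derivative_eq_intros has_real_derivative_divided_power[THEN DERIV_cong])
  then show ?case by simp
next
  case (Suc k)
  have "((\<lambda>\<tau>. divided_power k (\<tau> - a) * divided_power (Suc l) (e - \<tau>)
        - divided_power (Suc k) (\<tau> - a) * divided_power l (e - \<tau>)) has_integral
      divided_power (Suc k) (e - a) * divided_power (Suc l) (e - e)
      - divided_power (Suc k) (a - a) * divided_power (Suc l) (e - a)) {a..e}"
    using assms
    by (intro fundamental_theorem_of_calculus)
      (auto simp: has_real_derivative_iff_has_vector_derivative[symmetric]
        intro!: DERIV_mult[THEN DERIV_cong] has_real_derivative_divided_power derivative_eq_intros)
  from has_integral_diff[OF Suc[of "Suc l"] this] show ?case by simp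
qed

section \<open>The density of a word of live and dead particles\<close>

text \<open>A word lists, by increasing time, all particles created so far; \<open>True\<close> marks a live particle,
  \<open>False\<close> one that has been annihilated. When \<open>ts\<close> are increasing times in \<open>[a, b]\<close> of the live
  particles, the density is the volume of the possible times of the dead ones: each gap that
  the live times leave in \<open>[a, b]\<close> contributes the volume of a simplex. It is zero unless the number of live
  letters is the length of \<open>ts\<close>.\<close>

fun density :: "real \<Rightarrow> real \<Rightarrow> real list \<Rightarrow> bool list \<Rightarrow> real" where
  "density a b [] w = (if True \<in> set w then 0 else divided_power (length w) (b - a))"
| "density a b (t # ts) w = (let n = length (takeWhile Not w) in
    if True \<in> set w then divided_power n (t - a) * density t b ts (drop (Suc n) w) else 0)"

lemma takeWhile_Not_append_True:
  "True \<notin> set u \<Longrightarrow> takeWhile Not (u @ True # v) = u"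
  by (subst takeWhile_append2) auto

lemma density_Cons_split:
  assumes "True \<notin> set u"
  shows "density a b (t # ts) (u @ True # v)
    = divided_power (length u) (t - a) * density t b ts v"
  using assms by (simp add: takeWhile_Not_append_True)

lemma density_no_live: "True \<notin> set w \<Longrightarrow> density a b (t # ts) w = 0"
  by simp

text \<open>The dead letters before the first live one only enter through the volume of the first gap, which
  ends at the first live time, or at \<open>b\<close> when there is none. All dependence on \<open>a\<close> sits there.\<close>

lemma density_dead_prefix:
  obtains C where "\<And>a u. True \<notin> set u \<Longrightarrow>
    density a b ts (u @ dropWhile Not w) = divided_power (length u) ((if ts = [] then b else hd ts) - a) * C"
proof (cases "True \<in> set w")
  case True
  then have "dropWhile Not w \<noteq> []" by (auto simp: dropWhile_eq_Nil_conv)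
  moreover from this have "hd (dropWhile Not w)" using hd_dropWhile by blast
  ultimately obtain v where v: "dropWhile Not w = True # v"
    by (cases "dropWhile Not w") auto
  show thesis
  proof (cases ts)
    case Nil
    show thesis by (rule that[of 0]) (simp add: v Nil)
  next
    case (Cons t us)
    show thesis
      by (rule that[of "density t b us v"]) (simp add: v Cons density_Cons_split del: density.simps)
  qed
next
  case False
  then have [simp]: "dropWhile Not w = []"
    unfolding dropWhile_eq_Nil_conv by metis
  show thesis
  proof (cases ts)
    case Nil
    show thesis by (rule that[of 1]) (simp add: Nil)
  next
    case (Cons t us)
    show thesis by (rule that[of 0]) (simp add: Cons)
  qed
qed

text \<open>The recursion peels gaps off at the left end; this is the same product read from the right.\<close>

lemma density_append_live:
  assumes "True \<notin> set v"
  shows "density a b (ts @ [t]) (w @ True # v)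
    = density a t ts w * divided_power (length v) (b - t)"
proof (induction ts arbitrary: a w)
  case Nil
  show ?case
  proof (cases "True \<in> set w")
    case True
    obtain u u' where w: "w = u @ True # u'" and u: "True \<notin> set u"
      using split_list_first[OF True] by blast
    show ?thesis using assms by (simp add: w density_Cons_split[OF u] del: density.simps(2))
  next
    case False
    then show ?thesis using assms density_Cons_split[OF False, of a b t "[]" v] by (simp del: density.simps(2))
  qed
next
  case (Cons s ts)
  show ?case
  proof (cases "True \<in> set w")
    case True
    obtain u u' where w: "w = u @ True # u'" and u: "True \<notin> set u"
      using split_list_first[OF True] by blast
    show ?thesis using Cons[of s u'] by (simp add: w density_Cons_split[OF u] del: density.simps(2))
  next
    case False
    then show ?thesis using assms
      by (cases ts) (simp_all add: density_Cons_split del: density.simps(2), simp_all)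
  qed
qed

text \<open>Time reversal. It turns every statement about the left end of a tuple into one about the right
  end, so that only the left face needs a computation.\<close>

lemma density_reflect:
  "density (- b) (- a) (map uminus (rev ts)) (rev w) = density a b ts w"
proof (induction ts arbitrary: a w)
  case Nil
  then show ?case by simp
next
  case (Cons t ts)
  show ?case
  proof (cases "True \<in> set w")
    case True
    obtain u v where w: "w = u @ True # v" and u: "True \<notin> set u"
      using split_list_first[OF True] by blast
    have "density (- b) (- a) (map uminus (rev ts) @ [- t]) (rev v @ True # rev u)
        = density (- b) (- t) (map uminus (rev ts)) (rev v) * divided_power (length u) (t - a)"
      using u by (subst density_append_live) auto
    then show ?thesis using Cons[of t v] by (simp add: w density_Cons_split[OF u] del: density.simps(2))
  next
    case False
    then show ?thesis
      by (cases "map uminus (rev ts)") (simp_all)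
  qed
qed


declare density.simps(2) [simp del]


section \<open>Creation and annihilation on words\<close>

text \<open>A left creation puts its particle below all live ones, but its time relative to the dead
  ones is free: the new letter can go to any position with no live letter to its left. For the right
  face, left and right are exchanged.\<close>

definition insertion_points :: "face \<Rightarrow> bool list \<Rightarrow> nat set" where
  "insertion_points d w = {k. k \<le> length w
    \<and> True \<notin> set (case d of Left_Face \<Rightarrow> take k w | Right_Face \<Rightarrow> drop k w)}"

text \<open>The position of the live particle that an annihilation at the given face removes; the set is empty
  if all particles are dead, and a singleton otherwise.\<close>

definition outermost_live :: "face \<Rightarrow> bool list \<Rightarrow> nat set" where
  "outermost_live d w = {k. k < length w \<and> w ! k
    \<and> True \<notin> set (case d of Left_Face \<Rightarrow> take k w | Right_Face \<Rightarrow> drop (Suc k) w)}"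

lemma finite_insertion_points [simp]: "finite (insertion_points d w)"
  by (simp add: insertion_points_def)

lemma finite_outermost_live [simp]: "finite (outermost_live d w)"
  by (simp add: outermost_live_def)

lemma insertion_points_Left: "insertion_points Left_Face w = {..length (takeWhile Not w)}"
proof (intro set_eqI iffI)
  fix k assume "k \<in> insertion_points Left_Face w"
  then have k: "k \<le> length w" "True \<notin> set (take k w)" by (auto simp: insertion_points_def)
  have "takeWhile Not (take k w @ drop k w) = take k w @ takeWhile Not (drop k w)"
    using k(2) by (intro takeWhile_append2) auto
  then show "k \<in> {..length (takeWhile Not w)}"
    using k(1) by (simp add: min_def)
next
  fix k assume k: "k \<in> {..length (takeWhile Not w)}"
  then have "take k (takeWhile Not w @ dropWhile Not w) = take k (takeWhile Not w)"
    by (simp del: takeWhile_dropWhile_id)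
  then have "take k w = take k (takeWhile Not w)" by simp
  then have "True \<notin> set (take k w)" by (metis in_set_takeD set_takeWhileD)
  then show "k \<in> insertion_points Left_Face w"
    using k length_takeWhile_le[of Not w] by (simp add: insertion_points_def)
qed

lemma insertion_points_Right:
  "insertion_points Right_Face w = (\<lambda>k. length w - k) ` insertion_points Left_Face (rev w)"
proof (intro set_eqI iffI)
  fix k assume "k \<in> insertion_points Right_Face w"
  then have "k = length w - (length w - k)" "length w - k \<in> insertion_points Left_Face (rev w)"
    by (auto simp: insertion_points_def take_rev)
  then show "k \<in> (\<lambda>k. length w - k) ` insertion_points Left_Face (rev w)" by blast
qed (auto simp: insertion_points_def take_rev)

lemma outermost_live_Left:
  assumes "True \<notin> set u"
  shows "outermost_live Left_Face (u @ True # v) = {length u}"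
proof -
  have "k = length u" if "(u @ True # v) ! k" "True \<notin> set (take k (u @ True # v))"
    "k < length (u @ True # v)" for k
  proof (cases k "length u" rule: linorder_cases)
    case less
    then show ?thesis using that assms by (auto simp: nth_append dest: nth_mem)
  next
    case greater
    then have "True \<in> set (take k (u @ True # v))" by (cases "k - length u") auto
    then show ?thesis using that by simp
  qed
  then show ?thesis using assms by (auto simp: outermost_live_def)
qed

lemma outermost_live_Right:
  "outermost_live Right_Face w = (\<lambda>k. length w - Suc k) ` outermost_live Left_Face (rev w)"
proof (intro set_eqI iffI)
  fix k assume "k \<in> outermost_live Right_Face w"
  then have "k = length w - Suc (length w - Suc k)"
      "length w - Suc k \<in> outermost_live Left_Face (rev w)"
    by (auto simp: outermost_live_def take_rev rev_nth)
  then show "k \<in> (\<lambda>k. length w - Suc k) ` outermost_live Left_Face (rev w)" by blast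
qed (auto simp: outermost_live_def take_rev rev_nth Suc_diff_Suc)

lemma outermost_live_no_live: "True \<notin> set w \<Longrightarrow> outermost_live d w = {}"
  by (auto simp: outermost_live_def in_set_conv_nth)

text \<open>The live time \<open>t\<close> cuts the first gap in two, and the dead particles in that gap are distributed on
  the two parts in all possible ways.\<close>

lemma density_create_left:
  "density a b ts w
    = (\<Sum>k\<in>insertion_points Left_Face w. density a b (t # ts) (take k w @ True # drop k w))"
proof -
  define u v where "u = takeWhile Not w" and "v = dropWhile Not w"
  have w: "w = u @ v" by (simp add: u_def v_def)
  have u: "True \<notin> set u" using set_takeWhileD[of True Not w] by (auto simp: u_def)
  define e where "e = (if ts = [] then b else hd ts)"
  obtain C where C: "\<And>a u. True \<notin> set u \<Longrightarrow>
      density a b ts (u @ v) = divided_power (length u) (e - a) * C"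
    using density_dead_prefix[of b ts w] unfolding v_def e_def by blast
  have "density a b ts w = divided_power (length u) ((t - a) + (e - t)) * C"
    using C[OF u, of a] by (simp add: w)
  also have "\<dots> = (\<Sum>k\<le>length u. divided_power k (t - a)
      * (divided_power (length u - k) (e - t) * C))"
    unfolding divided_power_add by (simp add: sum_distrib_right mult.assoc)
  also have "\<dots> = (\<Sum>k\<le>length u. density a b (t # ts) (take k w @ True # drop k w))"
  proof (intro sum.cong refl)
    fix k assume k: "k \<in> {..length u}"
    have "True \<notin> set (take k u)" "True \<notin> set (drop k u)"
      using u by (auto dest: in_set_takeD in_set_dropD)
    then show "divided_power k (t - a) * (divided_power (length u - k) (e - t) * C)
        = density a b (t # ts) (take k w @ True # drop k w)"
      using k by (simp add: w density_Cons_split C min_def del: density.simps)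
  qed
  finally show ?thesis by (simp add: insertion_points_Left u_def)
qed

lemma density_create_right:
  "density a b ts w
    = (\<Sum>k\<in>insertion_points Right_Face w. density a b (ts @ [t]) (take k w @ True # drop k w))"
proof -
  have "density a b ts w = density (- b) (- a) (map uminus (rev ts)) (rev w)"
    by (rule density_reflect[symmetric])
  also have "\<dots> = (\<Sum>k\<in>insertion_points Left_Face (rev w).
      density (- b) (- a) (map uminus (rev (ts @ [t]))) (take k (rev w) @ True # drop k (rev w)))"
    using density_create_left[of "- b" "- a" "map uminus (rev ts)" "rev w" "- t"] by simp
  also have "\<dots> = (\<Sum>k\<in>insertion_points Left_Face (rev w). density a b (ts @ [t])
      (take (length w - k) w @ True # drop (length w - k) w))"
  proof (intro sum.cong refl)
    fix k
    have "take k (rev w) @ True # drop k (rev w)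
        = rev (take (length w - k) w @ True # drop (length w - k) w)"
      by (simp add: take_rev drop_rev)
    then show "density (- b) (- a) (map uminus (rev (ts @ [t]))) (take k (rev w) @ True # drop k (rev w))
        = density a b (ts @ [t]) (take (length w - k) w @ True # drop (length w - k) w)"
      by (simp only: density_reflect)
  qed
  also have "\<dots> = (\<Sum>k\<in>insertion_points Right_Face w.
      density a b (ts @ [t]) (take k w @ True # drop k w))"
    unfolding insertion_points_Right
    by (subst sum.reindex) (auto simp: inj_on_def insertion_points_def)
  finally show ?thesis .
qed

text \<open>Integrating out the first live time merges the first two gaps and leaves behind one more dead
  particle, by the Beta integral.\<close>

lemma density_annihilate_left:
  fixes ts :: "real list" and b :: real
  defines "e \<equiv> if ts = [] then b else hd ts"
  shows "continuous_on UNIV (\<lambda>\<tau>. density a b (\<tau> # ts) w)"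
    and "a \<le> e \<Longrightarrow> ((\<lambda>\<tau>. density a b (\<tau> # ts) w) has_integral
      (\<Sum>k\<in>outermost_live Left_Face w. density a b ts (w[k := False]))) {a..e}"
proof -
  have "continuous_on UNIV (\<lambda>\<tau>. density a b (\<tau> # ts) w) \<and> (a \<le> e \<longrightarrow>
    ((\<lambda>\<tau>. density a b (\<tau> # ts) w) has_integral
      (\<Sum>k\<in>outermost_live Left_Face w. density a b ts (w[k := False]))) {a..e})"
  proof (cases "True \<in> set w")
    case False
    then show ?thesis by (simp add: outermost_live_no_live density_no_live)
  next
    case True
    obtain u x where w: "w = u @ True # x" and u: "True \<notin> set u"
      using split_list_first[OF True] by blast
    define u' v where "u' = takeWhile Not x" and "v = dropWhile Not x"
    have x: "x = u' @ v" by (simp add: u'_def v_def)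
    have u': "True \<notin> set u'" using set_takeWhileD[of True Not x] by (auto simp: u'_def)
    obtain C where C: "\<And>a u. True \<notin> set u \<Longrightarrow>
        density a b ts (u @ v) = divided_power (length u) (e - a) * C"
      using density_dead_prefix[of b ts x] unfolding v_def e_def by blast
    have eq: "density a b (\<tau> # ts) w
        = divided_power (length u) (\<tau> - a) * divided_power (length u') (e - \<tau>) * C" for \<tau>
      by (simp add: w x density_Cons_split[OF u] C[OF u'] del: density.simps)
    have "True \<notin> set (u @ False # u')" using u u' by simp
    from C[OF this, of a] have "density a b ts (w[length u := False])
        = divided_power (Suc (length u + length u')) (e - a) * C"
      by (simp add: w x)
    moreover have "outermost_live Left_Face w = {length u}"
      unfolding w by (rule outermost_live_Left[OF u])
    ultimately have *: "(\<Sum>k\<in>outermost_live Left_Face w. density a b ts (w[k := False]))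
        = divided_power (Suc (length u + length u')) (e - a) * C" by simp
    show ?thesis
      unfolding eq *
      by (auto intro!: continuous_intros has_integral_mult_left divided_power_convolution)
  qed
  then show "continuous_on UNIV (\<lambda>\<tau>. density a b (\<tau> # ts) w)"
    and "a \<le> e \<Longrightarrow> ((\<lambda>\<tau>. density a b (\<tau> # ts) w) has_integral
      (\<Sum>k\<in>outermost_live Left_Face w. density a b ts (w[k := False]))) {a..e}"
    by simp_all
qed

lemma density_annihilate_right:
  fixes ts :: "real list" and a :: real
  defines "e \<equiv> if ts = [] then a else last ts"
  shows "continuous_on UNIV (\<lambda>\<tau>. density a b (ts @ [\<tau>]) w)"
    and "e \<le> b \<Longrightarrow> ((\<lambda>\<tau>. density a b (ts @ [\<tau>]) w) has_integral
      (\<Sum>k\<in>outermost_live Right_Face w. density a b ts (w[k := False]))) {e..b}"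
proof -
  let ?f = "\<lambda>\<sigma>. density (- b) (- a) (\<sigma> # map uminus (rev ts)) (rev w)"
  have eq: "density a b (ts @ [\<tau>]) w = ?f (- \<tau>)" for \<tau>
    using density_reflect[of b a "ts @ [\<tau>]" w] by simp
  show "continuous_on UNIV (\<lambda>\<tau>. density a b (ts @ [\<tau>]) w)"
    unfolding eq
    by (rule continuous_on_compose2[OF density_annihilate_left(1)]) (auto intro: continuous_intros)
  assume "e \<le> b"
  moreover have "- e = (if map uminus (rev ts) = [] then - a else hd (map uminus (rev ts)))"
    by (simp add: e_def hd_map hd_rev)
  ultimately have "(?f has_integral (\<Sum>k\<in>outermost_live Left_Face (rev w).
      density (- b) (- a) (map uminus (rev ts)) ((rev w)[k := False]))) {- b..- e}"
    using density_annihilate_left(2)[of "- b" "map uminus (rev ts)" "- a" "rev w"] by simp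
  also have "(\<Sum>k\<in>outermost_live Left_Face (rev w).
      density (- b) (- a) (map uminus (rev ts)) ((rev w)[k := False]))
    = (\<Sum>k\<in>outermost_live Left_Face (rev w). density a b ts (w[length w - Suc k := False]))"
  proof (intro sum.cong refl)
    fix k assume "k \<in> outermost_live Left_Face (rev w)"
    then have "(rev w)[k := False] = rev (w[length w - Suc k := False])"
      by (subst rev_update) (auto simp: outermost_live_def)
    then show "density (- b) (- a) (map uminus (rev ts)) ((rev w)[k := False])
        = density a b ts (w[length w - Suc k := False])"
      by (simp only: density_reflect)
  qed
  also have "\<dots> = (\<Sum>k\<in>outermost_live Right_Face w. density a b ts (w[k := False]))"
    unfolding outermost_live_Right
    by (subst sum.reindex) (auto simp: inj_on_def outermost_live_def)
  finally show "((\<lambda>\<tau>. density a b (ts @ [\<tau>]) w) has_integral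
      (\<Sum>k\<in>outermost_live Right_Face w. density a b ts (w[k := False]))) {e..b}"
    using has_integral_reflect_real[of "\<lambda>\<tau>. ?f (- \<tau>)" _ b e] by (simp only: eq minus_minus)
qed


section \<open>Configurations of partial blocks\<close>

text \<open>The positions of a pattern are processed from right to left, and a block starts with its larger
  element alone, as a live particle; the smaller element annihilates it. A singleton therefore
  stands for a block whose smaller element lies below everything processed so far. The predicate
  says that the particle of \<open>V\<close> is live when position \<open>b\<close> is processed.\<close>

definition spans :: "nat set \<Rightarrow> nat \<Rightarrow> bool" where
  "spans V b \<longleftrightarrow> (card V = 1 \<or> (\<exists>a\<in>V. a < b)) \<and> (\<exists>c\<in>V. b < c)"

text \<open>The condition on two blocks when the particle of \<open>X\<close> has a smaller time than that of \<open>Y\<close>: an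
  operator of the right face acts on a particle that is above all live ones, an operator of the left
  face on one that is below them.\<close>

definition compatible :: "(nat \<Rightarrow> face) \<Rightarrow> nat set \<Rightarrow> nat set \<Rightarrow> bool" where
  "compatible \<phi> X Y \<longleftrightarrow> X \<inter> Y = {} \<and> (\<forall>b\<in>X. \<phi> b = Right_Face \<longrightarrow> \<not> spans Y b)
    \<and> (\<forall>b\<in>Y. \<phi> b = Left_Face \<longrightarrow> \<not> spans X b)"

text \<open>The combinatorial record of a history of creations and annihilations at the positions \<open>A\<close>:
  the list of blocks by increasing time of their particles. Blocks with two elements are dead.\<close>

definition configs :: "(nat \<Rightarrow> face) \<Rightarrow> nat set \<Rightarrow> nat set list set" where
  "configs \<phi> A = {xs. \<Union>(set xs) = A \<and> (\<forall>V\<in>set xs. card V = 1 \<or> card V = 2)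
    \<and> sorted_wrt (compatible \<phi>) xs}"

abbreviation live_word :: "nat set list \<Rightarrow> bool list" where
  "live_word \<equiv> map (\<lambda>V. card V = 1)"

lemma configs_empty: "configs \<phi> {} = {[]}"
proof -
  have "xs = []" if "\<Union>(set xs) = {}" "\<forall>V\<in>set xs. card V = 1 \<or> card V = 2" for xs :: "nat set list"
    using that by (cases xs) auto
  then show ?thesis by (auto simp: configs_def)
qed

lemma configs_distinct:
  assumes "xs \<in> configs \<phi> A"
  shows "distinct xs"
proof -
  have "{} \<notin> set xs" using assms by (auto simp: configs_def)
  moreover have "sorted_wrt (\<lambda>X Y. X \<inter> Y = {}) xs"
  proof (rule sorted_wrt_mono_rel)
    show "sorted_wrt (compatible \<phi>) xs" using assms by (simp add: configs_def)
  qed (simp add: compatible_def)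
  ultimately show ?thesis by (induction xs) auto
qed

lemma finite_configs: "finite A \<Longrightarrow> finite (configs \<phi> A)"
  by (rule finite_subset[OF _ finite_subset_distinct[of "Pow A"]])
    (auto simp: configs_distinct, auto simp: configs_def)

text \<open>Completing a live block by a position below all others does not change at which of the earlier
  positions it was live.\<close>

lemma spans_insert:
  assumes "card V = 1" "i < b" "i \<notin> V"
  shows "spans (insert i V) b \<longleftrightarrow> spans V b"
proof -
  have "finite V" using assms(1) card_ge_0_finite by force
  then show ?thesis using assms by (auto simp: spans_def)
qed

text \<open>The case \<open>V = {}\<close> is the creation of a new block, the case of a singleton \<open>V\<close> the completion of
  a live one. Either way the position \<open>i\<close> only adds a condition on whether \<open>X\<close> is live.\<close>

lemma compatible_insert_right:
  assumes "\<And>x. x \<in> X \<Longrightarrow> i < x" "X \<noteq> {}" and V: "card V = 1 \<or> V = {}" "i \<notin> V"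
  shows "compatible \<phi> X (insert i V)
    \<longleftrightarrow> (V = {} \<or> compatible \<phi> X V) \<and> (\<phi> i = Left_Face \<longrightarrow> card X \<noteq> 1)"
proof -
  have "spans (insert i V) b \<longleftrightarrow> V \<noteq> {} \<and> spans V b" if "b \<in> X" for b
    using spans_insert[of V i b] V assms(1)[OF that] by (auto simp: spans_def)
  moreover have "spans X i \<longleftrightarrow> card X = 1"
    using assms(1,2) by (force simp: spans_def dest: less_asym)
  moreover have "i \<notin> X" using assms(1) by blast
  ultimately show ?thesis by (auto simp: compatible_def)
qed

lemma compatible_insert_left:
  assumes "\<And>y. y \<in> Y \<Longrightarrow> i < y" "Y \<noteq> {}" and V: "card V = 1 \<or> V = {}" "i \<notin> V"
  shows "compatible \<phi> (insert i V) Y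
    \<longleftrightarrow> (V = {} \<or> compatible \<phi> V Y) \<and> (\<phi> i = Right_Face \<longrightarrow> card Y \<noteq> 1)"
proof -
  have "spans (insert i V) b \<longleftrightarrow> V \<noteq> {} \<and> spans V b" if "b \<in> Y" for b
    using spans_insert[of V i b] V assms(1)[OF that] by (auto simp: spans_def)
  moreover have "spans Y i \<longleftrightarrow> card Y = 1"
    using assms(1,2) by (force simp: spans_def dest: less_asym)
  moreover have "i \<notin> Y" using assms(1) by blast
  ultimately show ?thesis by (auto simp: compatible_def)
qed

lemma sorted_wrt_compatible_insert:
  assumes "\<And>X. X \<in> set us \<union> set vs \<Longrightarrow> X \<noteq> {} \<and> (\<forall>x\<in>X. i < x)"
    and V: "card V = 1 \<or> V = {}" "i \<notin> V"
  shows "sorted_wrt (compatible \<phi>) (us @ insert i V # vs) \<longleftrightarrow>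
    sorted_wrt (compatible \<phi>) (us @ (if V = {} then [] else [V]) @ vs)
    \<and> True \<notin> set (live_word (case \<phi> i of Left_Face \<Rightarrow> us | Right_Face \<Rightarrow> vs))"
proof -
  have "compatible \<phi> X (insert i V)
      \<longleftrightarrow> (V = {} \<or> compatible \<phi> X V) \<and> (\<phi> i = Left_Face \<longrightarrow> card X \<noteq> 1)" if "X \<in> set us" for X
    by (rule compatible_insert_right) (use that assms in auto)
  moreover have "compatible \<phi> (insert i V) Y
      \<longleftrightarrow> (V = {} \<or> compatible \<phi> V Y) \<and> (\<phi> i = Right_Face \<longrightarrow> card Y \<noteq> 1)" if "Y \<in> set vs" for Y
    by (rule compatible_insert_left) (use that assms in auto)
  ultimately show ?thesis
    by (cases "\<phi> i") (auto simp: sorted_wrt_append)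
qed

context
  fixes \<phi> :: "nat \<Rightarrow> face" and A :: "nat set" and i :: nat
  assumes i: "\<And>a. a \<in> A \<Longrightarrow> i < a"
begin

lemma configs_insert_singleton_iff:
  "us @ {i} # vs \<in> configs \<phi> (insert i A) \<longleftrightarrow>
    us @ vs \<in> configs \<phi> A \<and> length us \<in> insertion_points (\<phi> i) (live_word (us @ vs))"
proof -
  have points: "length us \<in> insertion_points (\<phi> i) (live_word (us @ vs))
      \<longleftrightarrow> True \<notin> set (live_word (case \<phi> i of Left_Face \<Rightarrow> us | Right_Face \<Rightarrow> vs))"
    by (cases "\<phi> i") (simp_all add: insertion_points_def)
  have notin: "i \<notin> X" if "sorted_wrt (compatible \<phi>) (us @ {i} # vs)" "X \<in> set us \<union> set vs" for X
    using that by (auto simp: sorted_wrt_append compatible_def)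
  have U: "\<Union>(set (us @ {i} # vs)) = insert i A \<longleftrightarrow> \<Union>(set (us @ vs)) = A"
    if "\<And>X. X \<in> set us \<union> set vs \<Longrightarrow> i \<notin> X"
  proof -
    have "\<Union>(set (us @ {i} # vs)) = insert i (\<Union>(set (us @ vs)))" by auto
    moreover have "i \<notin> \<Union>(set (us @ vs))" using that by auto
    moreover have "i \<notin> A" using i by blast
    ultimately show ?thesis by (metis insert_ident)
  qed
  have "us @ {i} # vs \<in> configs \<phi> (insert i A) \<longleftrightarrow> \<Union>(set (us @ vs)) = A
      \<and> (\<forall>V\<in>set (us @ vs). card V = 1 \<or> card V = 2)
      \<and> sorted_wrt (compatible \<phi>) (us @ {i} # vs)"
    using U notin unfolding configs_def by auto
  also have "\<dots> \<longleftrightarrow> us @ vs \<in> configs \<phi> A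
      \<and> True \<notin> set (live_word (case \<phi> i of Left_Face \<Rightarrow> us | Right_Face \<Rightarrow> vs))"
  proof (cases "\<Union>(set (us @ vs)) = A \<and> (\<forall>V\<in>set (us @ vs). card V = 1 \<or> card V = 2)")
    case True
    have "X \<noteq> {} \<and> (\<forall>x\<in>X. i < x)" if X: "X \<in> set us \<union> set vs" for X
    proof
      have "card X = 1 \<or> card X = 2" using True X by auto
      then show "X \<noteq> {}" by auto
      have "X \<subseteq> A" using True X by auto
      then show "\<forall>x\<in>X. i < x" using i by blast
    qed
    from sorted_wrt_compatible_insert[of us vs i "{}", OF this] True
    show ?thesis by (simp add: configs_def)
  qed (auto simp: configs_def)
  finally show ?thesis by (simp only: points)
qed

lemma configs_insert_pair_iff:
  assumes V: "V \<noteq> {}" "i \<notin> V"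
  shows "us @ insert i V # vs \<in> configs \<phi> (insert i A) \<longleftrightarrow>
    us @ V # vs \<in> configs \<phi> A \<and> length us \<in> outermost_live (\<phi> i) (live_word (us @ V # vs))"
proof -
  have points: "length us \<in> outermost_live (\<phi> i) (live_word (us @ V # vs)) \<longleftrightarrow> card V = 1
      \<and> True \<notin> set (live_word (case \<phi> i of Left_Face \<Rightarrow> us | Right_Face \<Rightarrow> vs))"
    by (cases "\<phi> i") (auto simp: outermost_live_def nth_append)
  have card: "card (insert i V) = 1 \<or> card (insert i V) = 2 \<longleftrightarrow> card V = 1"
  proof (cases "finite V")
    case True
    then show ?thesis using V by (auto simp: card_eq_0_iff)
  qed simp
  have notin: "i \<notin> X" if "sorted_wrt (compatible \<phi>) (us @ insert i V # vs)" "X \<in> set us \<union> set vs" for X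
    using that by (auto simp: sorted_wrt_append compatible_def)
  have U: "\<Union>(set (us @ insert i V # vs)) = insert i A \<longleftrightarrow> \<Union>(set (us @ V # vs)) = A"
    if "\<And>X. X \<in> set us \<union> set vs \<Longrightarrow> i \<notin> X"
  proof -
    have "\<Union>(set (us @ insert i V # vs)) = insert i (\<Union>(set (us @ V # vs)))" by auto
    moreover have "i \<notin> \<Union>(set (us @ V # vs))" using that V by auto
    moreover have "i \<notin> A" using i by blast
    ultimately show ?thesis by (metis insert_ident)
  qed
  have "us @ insert i V # vs \<in> configs \<phi> (insert i A) \<longleftrightarrow> \<Union>(set (us @ V # vs)) = A
      \<and> (\<forall>V\<in>set (us @ vs). card V = 1 \<or> card V = 2) \<and> card V = 1
      \<and> sorted_wrt (compatible \<phi>) (us @ insert i V # vs)"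
    using U notin card unfolding configs_def by auto
  also have "\<dots> \<longleftrightarrow> us @ V # vs \<in> configs \<phi> A \<and> card V = 1
      \<and> True \<notin> set (live_word (case \<phi> i of Left_Face \<Rightarrow> us | Right_Face \<Rightarrow> vs))"
  proof (cases "\<Union>(set (us @ V # vs)) = A
      \<and> (\<forall>V\<in>set (us @ vs). card V = 1 \<or> card V = 2) \<and> card V = 1")
    case True
    have "X \<noteq> {} \<and> (\<forall>x\<in>X. i < x)" if X: "X \<in> set us \<union> set vs" for X
    proof
      have "card X = 1 \<or> card X = 2" using True X by auto
      then show "X \<noteq> {}" by auto
      have "X \<subseteq> A" using True X by auto
      then show "\<forall>x\<in>X. i < x" using i by blast
    qed
    from sorted_wrt_compatible_insert[of us vs i V, OF this] True V
    show ?thesis by (auto simp: configs_def)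
  qed (auto simp: configs_def)
  finally show ?thesis by (simp only: points)
qed

definition "open_block xs k = take k xs @ {i} # drop k xs"
definition "close_block xs k = xs[k := insert i (xs ! k)]"

lemma notin_configs:
  assumes "xs \<in> configs \<phi> A" "X \<in> set xs"
  shows "i \<notin> X" "X \<noteq> {}"
  using assms i by (auto simp: configs_def)

lemma inj_on_open_block:
  "inj_on (\<lambda>(xs, k). open_block xs k) (SIGMA xs:configs \<phi> A. insertion_points (\<phi> i) (live_word xs))"
proof (rule inj_onI, clarify)
  fix xs k ys l
  assume xs: "xs \<in> configs \<phi> A" "k \<in> insertion_points (\<phi> i) (live_word xs)"
    and ys: "ys \<in> configs \<phi> A" "l \<in> insertion_points (\<phi> i) (live_word ys)"
    and eq: "open_block xs k = open_block ys l"
  have "{i} \<notin> set (take k xs)" "{i} \<notin> set (drop k xs)"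
    using notin_configs(1)[OF xs(1)] by (auto dest: in_set_takeD in_set_dropD)
  with eq have *: "take k xs = take l ys" "drop k xs = drop l ys"
    by (simp_all add: open_block_def append_Cons_eq_iff)
  then have "xs = ys" by (metis append_take_drop_id)
  moreover have "k = l"
    using arg_cong[OF *(1), of length] xs(2) ys(2) by (simp add: insertion_points_def)
  ultimately show "xs = ys \<and> k = l" by simp
qed

lemma inj_on_close_block:
  "inj_on (\<lambda>(xs, k). close_block xs k) (SIGMA xs:configs \<phi> A. outermost_live (\<phi> i) (live_word xs))"
proof (rule inj_onI, clarify)
  fix xs k ys l
  assume xs: "xs \<in> configs \<phi> A" "k \<in> outermost_live (\<phi> i) (live_word xs)"
    and ys: "ys \<in> configs \<phi> A" "l \<in> outermost_live (\<phi> i) (live_word ys)"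
    and eq: "close_block xs k = close_block ys l"
  \<comment> \<open>Since \<open>i\<close> is new, deleting it from all blocks recovers the previous configuration.\<close>
  have remove: "map (\<lambda>X. X - {i}) (close_block zs k) = zs" if "zs \<in> configs \<phi> A" for zs k
    unfolding close_block_def using notin_configs(1)[OF that]
    by (cases "k < length zs") (auto intro!: nth_equalityI simp: nth_list_update split: if_splits)
  have "xs = ys" using remove[OF xs(1), of k] remove[OF ys(1), of l] eq by simp
  moreover have "k = l"
  proof (rule ccontr)
    assume "k \<noteq> l"
    have k: "k < length xs" using xs(2) by (simp add: outermost_live_def)
    then have "i \<in> close_block xs k ! k" by (simp add: close_block_def)
    moreover have "close_block ys l ! k = xs ! k"
      using \<open>k \<noteq> l\<close> \<open>xs = ys\<close> by (simp add: close_block_def)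
    ultimately show False using notin_configs(1)[OF xs(1) nth_mem[OF k]] eq by simp
  qed
  ultimately show "xs = ys \<and> k = l" by simp
qed

text \<open>One step of the process: \<open>i\<close> forms a block of its own at an admissible place, or it completes
  the outermost live block. These are exactly the moves that the two operators make on words.\<close>

lemma configs_insert:
  "configs \<phi> (insert i A)
    = (\<lambda>(xs, k). open_block xs k) ` (SIGMA xs:configs \<phi> A. insertion_points (\<phi> i) (live_word xs))
    \<union> (\<lambda>(xs, k). close_block xs k) ` (SIGMA xs:configs \<phi> A. outermost_live (\<phi> i) (live_word xs))"
    (is "_ = ?open \<union> ?close")
proof (intro equalityI subsetI)
  fix zs assume zs: "zs \<in> configs \<phi> (insert i A)"
  then have "i \<in> \<Union>(set zs)" by (simp add: configs_def)
  then obtain W where "i \<in> W" "W \<in> set zs" by blast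
  then obtain us V vs where zs_eq: "zs = us @ insert i V # vs" and V: "i \<notin> V"
    by (metis Set.set_insert split_list)
  show "zs \<in> ?open \<union> ?close"
  proof (cases "V = {}")
    case True
    then have "(us @ vs, length us) \<in> (SIGMA xs:configs \<phi> A. insertion_points (\<phi> i) (live_word xs))"
      using zs configs_insert_singleton_iff[of us vs] zs_eq by simp
    moreover have "zs = open_block (us @ vs) (length us)"
      using True by (simp add: zs_eq open_block_def)
    ultimately show ?thesis by (auto intro!: rev_image_eqI)
  next
    case False
    then have "(us @ V # vs, length us) \<in> (SIGMA xs:configs \<phi> A. outermost_live (\<phi> i) (live_word xs))"
      using zs configs_insert_pair_iff[OF False V, of us vs] zs_eq by simp
    moreover have "zs = close_block (us @ V # vs) (length us)"
      by (simp add: zs_eq close_block_def)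
    ultimately show ?thesis by (auto intro!: rev_image_eqI)
  qed
next
  fix zs assume "zs \<in> ?open \<union> ?close"
  then show "zs \<in> configs \<phi> (insert i A)"
  proof
    assume "zs \<in> ?open"
    then obtain xs k where xs: "xs \<in> configs \<phi> A" "k \<in> insertion_points (\<phi> i) (live_word xs)"
      and zs: "zs = open_block xs k" by auto
    moreover have "length (take k xs) = k" using xs(2) by (simp add: insertion_points_def)
    ultimately show ?thesis
      using configs_insert_singleton_iff[of "take k xs" "drop k xs"] by (simp add: open_block_def)
  next
    assume "zs \<in> ?close"
    then obtain xs k where xs: "xs \<in> configs \<phi> A" "k \<in> outermost_live (\<phi> i) (live_word xs)"
      and zs: "zs = close_block xs k" by auto
    have k: "k < length xs" using xs(2) by (simp add: outermost_live_def)
    then have split: "xs = take k xs @ xs ! k # drop (Suc k) xs" by (rule id_take_nth_drop)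
    show ?thesis
      using configs_insert_pair_iff[of "xs ! k" "take k xs" "drop (Suc k) xs"] xs k
        notin_configs[OF xs(1) nth_mem[OF k]] split
      by (simp add: zs close_block_def upd_conv_take_nth_drop)
  qed
qed

text \<open>Each new configuration arises from exactly one old configuration by exactly one move, so a sum over
  configurations of their words follows the moves on words.\<close>

lemma sum_configs_insert:
  fixes f :: "bool list \<Rightarrow> real"
  assumes "finite A"
  shows "(\<Sum>xs\<in>configs \<phi> (insert i A). f (live_word xs)) = (\<Sum>xs\<in>configs \<phi> A.
      (\<Sum>k\<in>insertion_points (\<phi> i) (live_word xs).
        f (take k (live_word xs) @ True # drop k (live_word xs)))
      + (\<Sum>k\<in>outermost_live (\<phi> i) (live_word xs). f ((live_word xs)[k := False])))"
    (is "_ = (\<Sum>xs\<in>_. ?L xs + ?R xs)")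
proof -
  let ?S = "SIGMA xs:configs \<phi> A. insertion_points (\<phi> i) (live_word xs)"
  let ?T = "SIGMA xs:configs \<phi> A. outermost_live (\<phi> i) (live_word xs)"
  let ?open = "(\<lambda>(xs, k). open_block xs k) ` ?S" and ?close = "(\<lambda>(xs, k). close_block xs k) ` ?T"
  have fin: "finite (configs \<phi> A)" using assms by (rule finite_configs)
  have "{i} \<in> set zs" if "zs \<in> ?open" for zs
    using that by (auto simp: open_block_def)
  moreover have "{i} \<notin> set zs" if "zs \<in> ?close" for zs
  proof
    assume "{i} \<in> set zs"
    from that obtain xs k where xs: "xs \<in> configs \<phi> A" "k \<in> outermost_live (\<phi> i) (live_word xs)"
      and zs: "zs = close_block xs k" by auto
    then have k: "k < length xs" by (simp add: outermost_live_def)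
    have "{i} \<in> insert (insert i (xs ! k)) (set xs)"
      using \<open>{i} \<in> set zs\<close> set_update_subset_insert[of xs k "insert i (xs ! k)"]
      by (auto simp: zs close_block_def)
    then show False using notin_configs[OF xs(1)] notin_configs[OF xs(1) nth_mem[OF k]] by auto
  qed
  ultimately have "?open \<inter> ?close = {}" by blast
  then have "(\<Sum>xs\<in>configs \<phi> (insert i A). f (live_word xs))
      = (\<Sum>xs\<in>?open. f (live_word xs)) + (\<Sum>xs\<in>?close. f (live_word xs))"
    unfolding configs_insert using fin by (intro sum.union_disjoint finite_imageI finite_SigmaI) auto
  also have "(\<Sum>xs\<in>?open. f (live_word xs)) = (\<Sum>(xs, k)\<in>?S. f (live_word (open_block xs k)))"
    by (subst sum.reindex[OF inj_on_open_block]) (simp add: split_beta' o_def)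
  also have "\<dots> = (\<Sum>xs\<in>configs \<phi> A. ?L xs)"
    using fin by (subst sum.Sigma[symmetric]) (auto simp: open_block_def take_map drop_map)
  also have "(\<Sum>xs\<in>?close. f (live_word xs)) = (\<Sum>(xs, k)\<in>?T. f (live_word (close_block xs k)))"
    by (subst sum.reindex[OF inj_on_close_block]) (simp add: split_beta' o_def)
  also have "\<dots> = (\<Sum>xs\<in>configs \<phi> A. \<Sum>k\<in>outermost_live (\<phi> i) (live_word xs).
      f (live_word (close_block xs k)))"
    using fin by (subst sum.Sigma[symmetric]) auto
  also have "\<dots> = (\<Sum>xs\<in>configs \<phi> A. ?R xs)"
  proof (intro sum.cong refl)
    fix xs k assume xs: "xs \<in> configs \<phi> A" "k \<in> outermost_live (\<phi> i) (live_word xs)"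
    then have k: "k < length xs" "card (xs ! k) = 1" by (auto simp: outermost_live_def)
    then have "finite (xs ! k)" using card_ge_0_finite by force
    then have "card (insert i (xs ! k)) \<noteq> 1"
      using k(2) notin_configs(1)[OF xs(1) nth_mem[OF k(1)]] by simp
    then show "f (live_word (close_block xs k)) = f ((live_word xs)[k := False])"
      by (simp add: close_block_def map_update)
  qed
  finally show ?thesis by (simp add: sum.distrib)
qed

end


section \<open>The vectors generated from the vacuum\<close>

text \<open>The field operator of \<open>[0, 1]\<close> on representing functions.\<close>

definition field_step ::
  "face \<Rightarrow> (real list \<Rightarrow> complex) \<Rightarrow> real list \<Rightarrow> complex" where
  "field_step d g ts = (case d of
      Left_Face \<Rightarrow> (if ts = [] then 0 else indicator {0..1} (hd ts) * g (tl ts))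
        + (LINT \<tau>:{\<tau>. ts \<noteq> [] \<longrightarrow> \<tau> < hd ts}|lborel. cnj (indicator {0..1} \<tau>) * g (\<tau> # ts))
    | Right_Face \<Rightarrow> (if ts = [] then 0 else g (butlast ts) * indicator {0..1} (last ts))
        + (LINT \<tau>:{\<tau>. ts \<noteq> [] \<longrightarrow> last ts < \<tau>}|lborel. cnj (indicator {0..1} \<tau>) * g (ts @ [\<tau>])))"

lemma square_integrable_indicator: "square_integrable lborel (indicator {0..1::real})"
proof -
  have "(\<lambda>x. (cmod (indicator {0..1::real} x))\<^sup>2) = indicator {0..1}"
    by (auto simp: indicator_def)
  then show ?thesis by (simp add: square_integrable_def)
qed

lemma cr_fock_field_operator:
  assumes "cr_fock g x"
  shows "cr_fock (field_step d g) (field_operator 0 1 d x)"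
proof -
  note pcr = fock.pcr_cr_eq
  have sq: "square_integrable lborel (indicator {0..1::real})" by (rule square_integrable_indicator)
  show ?thesis
  proof (cases d)
    case Left_Face
    have "cr_fock (\<lambda>ts. (if ts = [] then 0 else indicator {0..1} (hd ts) * g (tl ts))
        + (LINT \<tau>:{\<tau>. ts \<noteq> [] \<longrightarrow> \<tau> < hd ts}|lborel. cnj (indicator {0..1} \<tau>) * g (\<tau> # ts)))
      (left_creation (indicator {0..1}) x + left_annihilation (indicator {0..1}) x)"
      using plus_fock.transfer[unfolded pcr, THEN rel_funD, THEN rel_funD,
          OF left_creation.transfer[unfolded pcr, THEN rel_funD, THEN rel_funD, OF refl assms]
            left_annihilation.transfer[unfolded pcr, THEN rel_funD, THEN rel_funD, OF refl assms],
          of "indicator {0..1}" "indicator {0..1}"]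
      by (simp only: sq if_True)
    then show ?thesis by (simp add: Left_Face field_step_def[abs_def] field_operator_def)
  next
    case Right_Face
    have "cr_fock (\<lambda>ts. (if ts = [] then 0 else g (butlast ts) * indicator {0..1} (last ts))
        + (LINT \<tau>:{\<tau>. ts \<noteq> [] \<longrightarrow> last ts < \<tau>}|lborel. cnj (indicator {0..1} \<tau>) * g (ts @ [\<tau>])))
      (right_creation (indicator {0..1}) x + right_annihilation (indicator {0..1}) x)"
      using plus_fock.transfer[unfolded pcr, THEN rel_funD, THEN rel_funD,
          OF right_creation.transfer[unfolded pcr, THEN rel_funD, THEN rel_funD, OF refl assms]
            right_annihilation.transfer[unfolded pcr, THEN rel_funD, THEN rel_funD, OF refl assms],
          of "indicator {0..1}" "indicator {0..1}"]
      by (simp only: sq if_True)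
    then show ?thesis by (simp add: Right_Face field_step_def[abs_def] field_operator_def)
  qed
qed

text \<open>The function on tuples obtained from the vacuum by the field operators at the positions \<open>A\<close>: given
  the live times, it adds up the volumes of the dead times over all histories. All times lie in
  \<open>[0, 1]\<close>, the support of the test function.\<close>

definition config_vector :: "(nat \<Rightarrow> face) \<Rightarrow> nat set \<Rightarrow> real list \<Rightarrow> complex" where
  "config_vector \<phi> A ts = (if set ts \<subseteq> {0..1}
    then of_real (\<Sum>xs\<in>configs \<phi> A. density 0 1 ts (live_word xs)) else 0)"

text \<open>The annihilation integral over \<open>D\<close> is cut down to \<open>[0, 1]\<close> by the test function; up to a null
  set this leaves an interval, on which the integral of a continuous function is known.\<close>

lemma set_integral_indicator_of_real:
  fixes G :: "real \<Rightarrow> real" and D :: "real set"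
  assumes cont: "continuous_on UNIV G" and I: "(G has_integral I) {l..u}"
    and D: "AE \<tau> in lborel. \<tau> \<in> {l..u} \<longleftrightarrow> \<tau> \<in> D \<inter> {0..1}" and [measurable]: "D \<in> sets borel"
    and g: "\<And>\<tau>. \<tau> \<in> {0..1} \<Longrightarrow> g \<tau> = complex_of_real (G \<tau>)"
  shows "(LINT \<tau>:D|lborel. cnj (indicator {0..1} \<tau>) * g \<tau>) = complex_of_real I"
proof -
  have [measurable]: "G \<in> borel_measurable borel"
    by (rule borel_measurable_continuous_onI) (rule cont)
  have "(LINT \<tau>:D|lborel. cnj (indicator {0..1} \<tau>) * g \<tau>)
      = (LINT \<tau>|lborel. complex_of_real (indicator (D \<inter> {0..1}) \<tau> *\<^sub>R G \<tau>))"
    unfolding set_lebesgue_integral_def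
    by (intro Bochner_Integration.integral_cong) (auto simp: indicator_def g)
  also have "\<dots> = complex_of_real (LINT \<tau>:D \<inter> {0..1}|lborel. G \<tau>)"
    unfolding set_lebesgue_integral_def by (rule integral_complex_of_real)
  also have "(LINT \<tau>:D \<inter> {0..1}|lborel. G \<tau>) = (LINT \<tau>:{l..u}|lborel. G \<tau>)"
    by (intro set_integral_cong_set D) (auto simp: set_borel_measurable_def)
  also have "\<dots> = integral {l..u} G"
    using cont by (intro set_borel_integral_eq_integral borel_integrable_atLeastAtMost')
      (auto intro: continuous_on_subset)
  also have "\<dots> = I" using I by (rule integral_unique)
  finally show ?thesis .
qed

text \<open>Creation and annihilation act on the density of each word as they act on configurations. The
  identity holds at every tuple, increasing or not, so no null sets have to be tracked.\<close>

lemma field_step_config_vector: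
  assumes A: "finite A" "\<And>a. a \<in> A \<Longrightarrow> i < a"
  shows "field_step (\<phi> i) (config_vector \<phi> A) = config_vector \<phi> (insert i A)"
proof
  fix ts :: "real list"
  let ?w = live_word
  let ?create = "\<lambda>d. (\<Sum>xs\<in>configs \<phi> A. \<Sum>k\<in>insertion_points d (?w xs).
    density 0 1 ts (take k (?w xs) @ True # drop k (?w xs)))"
  let ?annihilate = "\<lambda>d. (\<Sum>xs\<in>configs \<phi> A. \<Sum>k\<in>outermost_live d (?w xs).
    density 0 1 ts ((?w xs)[k := False]))"
  have split: "(\<Sum>xs\<in>configs \<phi> (insert i A). density 0 1 ts (?w xs)) = ?create (\<phi> i) + ?annihilate (\<phi> i)"
    using sum_configs_insert[of A i "density 0 1 ts" \<phi>] A by (simp add: sum.distrib)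
  have fin: "finite (configs \<phi> A)" using A(1) by (rule finite_configs)
  have nil: "?create d = 0" if "ts = []" for d using that by simp
  show "field_step (\<phi> i) (config_vector \<phi> A) ts = config_vector \<phi> (insert i A) ts"
  proof (cases "set ts \<subseteq> {0..1}")
    case False
    then have "ts \<noteq> []" by auto
    moreover have "indicator {0..1} (hd ts) * config_vector \<phi> A (tl ts) = 0"
      using False \<open>ts \<noteq> []\<close> by (cases ts) (auto simp: config_vector_def)
    moreover have "config_vector \<phi> A (butlast ts) * indicator {0..1} (last ts) = 0"
      using False \<open>ts \<noteq> []\<close> by (cases ts rule: rev_cases) (auto simp: config_vector_def)
    moreover have "config_vector \<phi> A (\<tau> # ts) = 0" "config_vector \<phi> A (ts @ [\<tau>]) = 0" for \<tau>
      using False by (auto simp: config_vector_def)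
    ultimately show ?thesis
      using False by (cases "\<phi> i") (simp_all add: field_step_def config_vector_def)
  next
    case True
    show ?thesis
    proof (cases "\<phi> i")
      case Left_Face
      define e where "e = (if ts = [] then 1 else hd ts)"
      have e: "0 \<le> e" "e \<le> 1" using True by (cases ts; auto simp: e_def)+
      have "(if ts = [] then 0 else indicator {0..1} (hd ts) * config_vector \<phi> A (tl ts))
          = complex_of_real (?create Left_Face)"
      proof (cases ts)
        case (Cons t us)
        then show ?thesis
          using True density_create_left[of 0 1 us _ t] by (simp add: config_vector_def)
      qed (simp only: nil, simp)
      moreover have "(LINT \<tau>:{\<tau>. ts \<noteq> [] \<longrightarrow> \<tau> < hd ts}|lborel.
          cnj (indicator {0..1} \<tau>) * config_vector \<phi> A (\<tau> # ts)) = complex_of_real (?annihilate Left_Face)"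
      proof (rule set_integral_indicator_of_real)
        show "continuous_on UNIV (\<lambda>\<tau>. \<Sum>xs\<in>configs \<phi> A. density 0 1 (\<tau> # ts) (?w xs))"
          by (intro continuous_on_sum density_annihilate_left(1))
        show "((\<lambda>\<tau>. \<Sum>xs\<in>configs \<phi> A. density 0 1 (\<tau> # ts) (?w xs)) has_integral
            ?annihilate Left_Face) {0..e}"
          using fin e(1) unfolding e_def by (intro has_integral_sum density_annihilate_left(2))
        \<comment> \<open>The integration domain misses its end point \<open>e\<close> when there are live particles.\<close>
        have "AE \<tau> in lborel. \<tau> \<noteq> e" by (rule AE_lborel_singleton)
        then show "AE \<tau> in lborel. \<tau> \<in> {0..e} \<longleftrightarrow> \<tau> \<in> {\<tau>. ts \<noteq> [] \<longrightarrow> \<tau> < hd ts} \<inter> {0..1}"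
          by eventually_elim (use e in \<open>auto simp: e_def\<close>)
        show "{\<tau>. ts \<noteq> [] \<longrightarrow> \<tau> < hd ts} \<in> sets borel" by (cases "ts = []") auto
      qed (use True in \<open>simp add: config_vector_def\<close>)
      ultimately show ?thesis
        using True split by (simp add: field_step_def config_vector_def Left_Face)
    next
      case Right_Face
      define e where "e = (if ts = [] then 0 else last ts)"
      have e: "0 \<le> e" "e \<le> 1" using True by (cases ts rule: rev_cases; auto simp: e_def)+
      have "(if ts = [] then 0 else config_vector \<phi> A (butlast ts) * indicator {0..1} (last ts))
          = complex_of_real (?create Right_Face)"
      proof (cases ts rule: rev_cases)
        case (snoc us t)
        then show ?thesis
          using True density_create_right[of 0 1 us _ t] by (simp add: config_vector_def)
      qed (simp only: nil, simp)
      moreover have "(LINT \<tau>:{\<tau>. ts \<noteq> [] \<longrightarrow> last ts < \<tau>}|lborel.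
          cnj (indicator {0..1} \<tau>) * config_vector \<phi> A (ts @ [\<tau>])) = complex_of_real (?annihilate Right_Face)"
      proof (rule set_integral_indicator_of_real)
        show "continuous_on UNIV (\<lambda>\<tau>. \<Sum>xs\<in>configs \<phi> A. density 0 1 (ts @ [\<tau>]) (?w xs))"
          by (intro continuous_on_sum density_annihilate_right(1))
        show "((\<lambda>\<tau>. \<Sum>xs\<in>configs \<phi> A. density 0 1 (ts @ [\<tau>]) (?w xs)) has_integral
            ?annihilate Right_Face) {e..1}"
          using fin e(2) unfolding e_def by (intro has_integral_sum density_annihilate_right(2))
        have "AE \<tau> in lborel. \<tau> \<noteq> e" by (rule AE_lborel_singleton)
        then show "AE \<tau> in lborel. \<tau> \<in> {e..1} \<longleftrightarrow> \<tau> \<in> {\<tau>. ts \<noteq> [] \<longrightarrow> last ts < \<tau>} \<inter> {0..1}"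
          by eventually_elim (use e in \<open>auto simp: e_def\<close>)
        show "{\<tau>. ts \<noteq> [] \<longrightarrow> last ts < \<tau>} \<in> sets borel" by (cases "ts = []") auto
      qed (use True in \<open>simp add: config_vector_def\<close>)
      ultimately show ?thesis
        using True split by (simp add: field_step_def config_vector_def Right_Face)
    qed
  qed
qed

lemma config_vector_empty: "config_vector \<phi> {} = (\<lambda>ts. if ts = [] then 1 else 0)"
proof
  fix ts show "config_vector \<phi> {} ts = (if ts = [] then 1 else 0)"
    by (cases ts) (simp_all add: config_vector_def configs_empty density_no_live)
qed

text \<open>The rightmost operator acts first, so the induction adds positions from the end of the pattern
  downwards. The operator at list index \<open>m\<close> has position \<open>m + 1\<close>.\<close>

lemma cr_fock_operator_product:
  assumes "m \<le> length \<delta>"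
  shows "cr_fock (config_vector (\<lambda>i. \<delta> ! (i - 1)) {m<..length \<delta>})
    (operator_product (map (field_operator 0 1) (drop m \<delta>)) vacuum)"
  using assms
proof (induction m rule: inc_induct)
  case base
  show ?case
    using vacuum.transfer by (simp add: fock.pcr_cr_eq operator_product_def config_vector_empty)
next
  case (step m)
  let ?\<phi> = "\<lambda>i. \<delta> ! (i - 1)"
  have "{m<..length \<delta>} = insert (Suc m) {Suc m<..length \<delta>}" using step.hyps by auto
  then have "config_vector ?\<phi> {m<..length \<delta>}
      = field_step (\<delta> ! m) (config_vector ?\<phi> {Suc m<..length \<delta>})"
    using field_step_config_vector[of "{Suc m<..length \<delta>}" "Suc m" ?\<phi>] by simp
  moreover have "drop m \<delta> = \<delta> ! m # drop (Suc m) \<delta>"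
    using step.hyps by (simp add: Cons_nth_drop_Suc)
  ultimately show ?case
    using cr_fock_field_operator[OF step.IH, of "\<delta> ! m"] by (simp add: operator_product_def)
qed

text \<open>The empty tuple is an atom of mass \<open>1\<close>.\<close>

lemma integral_inc_tuples_Nil:
  "(LINT ts|inc_tuples. cnj (if ts = [] then 1 else 0) * g ts) = (g [] :: complex)"
proof -
  have Nil: "{[]} \<in> sets tuples"
    using left.Nil_measurable by (simp add: pred_def)
  then have Nil': "{[]} \<in> sets inc_tuples" and inc: "[] \<in> increasing_tuples"
    by (auto simp: inc_tuples_def sets_restrict_space increasing_tuples_def intro!: image_eqI[of _ _ "{[]}"])
  have "emeasure inc_tuples {[]} = emeasure tuples {[]}"
    unfolding inc_tuples_def using inc by (intro emeasure_restrict_space) (simp_all add: increasing_tuples_in_sets)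
  also have "\<dots> = (\<integral>\<^sup>+ts. indicator {[]} ts \<partial>tuples)" using Nil by simp
  also have "\<dots> = 1" using Nil by (subst nn_integral_tuples_Cons) auto
  finally have "emeasure inc_tuples {[]} = 1" .
  then have "measure inc_tuples {[]} = 1" by (simp add: measure_def)
  have "(LINT ts|inc_tuples. cnj (if ts = [] then 1 else 0) * g ts)
      = (LINT ts|inc_tuples. indicator {[]} ts *\<^sub>R g [])"
    by (intro Bochner_Integration.integral_cong) (auto simp: indicator_def)
  also have "\<dots> = measure inc_tuples {[]} *\<^sub>R g []"
    using Nil' \<open>emeasure inc_tuples {[]} = 1\<close>
    by (intro has_bochner_integral_integral_eq has_bochner_integral_indicator) simp_all
  finally show ?thesis by (simp add: \<open>measure inc_tuples {[]} = 1\<close>)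
qed

lemma vacuum_expectation:
  "fock_inner vacuum (operator_product (map (field_operator 0 1) \<delta>) vacuum)
    = of_real (\<Sum>xs\<in>configs (\<lambda>i. \<delta> ! (i - 1)) {0<..length \<delta>}. density 0 1 [] (live_word xs))"
proof -
  have "fock_inner vacuum (operator_product (map (field_operator 0 1) \<delta>) vacuum)
      = (LINT ts|inc_tuples. cnj (if ts = [] then 1 else 0)
          * config_vector (\<lambda>i. \<delta> ! (i - 1)) {0<..length \<delta>} ts)"
    using fock_inner.transfer[unfolded fock.pcr_cr_eq, THEN rel_funD, THEN rel_funD,
        OF vacuum.transfer[unfolded fock.pcr_cr_eq] cr_fock_operator_product[of 0 \<delta>]]
    by simp
  then show ?thesis by (simp add: integral_inc_tuples_Nil config_vector_def)
qed


section \<open>Total orders as lists\<close>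

text \<open>The order is by decreasing index. Lists of blocks are sorted by increasing time, whereas in a
  bi-monotone partition the block of an operator of the right face, whose time is above those of the
  live particles, has to be the smaller one.\<close>

definition list_order :: "'a list \<Rightarrow> 'a rel" where
  "list_order xs = {(xs ! j, xs ! k) | j k. k \<le> j \<and> j < length xs}"

lemma in_list_order_iff:
  assumes "distinct xs" "j < length xs" "k < length xs"
  shows "(xs ! j, xs ! k) \<in> list_order xs \<longleftrightarrow> k \<le> j"
proof
  assume "(xs ! j, xs ! k) \<in> list_order xs"
  then obtain j' k' where "xs ! j = xs ! j'" "xs ! k = xs ! k'" "k' \<le> j'" "j' < length xs"
    by (auto simp: list_order_def)
  then show "k \<le> j" using assms by (simp add: nth_eq_iff_index_eq)
qed (use assms in \<open>auto simp: list_order_def\<close>)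

lemma list_order_subset: "list_order xs \<subseteq> set xs \<times> set xs"
  by (auto simp: list_order_def)

lemma linear_order_list_order:
  assumes "distinct xs"
  shows "linear_order_on (set xs) (list_order xs)"
proof -
  note iff = in_list_order_iff[OF assms]
  have "trans (list_order xs)"
  proof (rule transI)
    fix x y z assume xy: "(x, y) \<in> list_order xs" and yz: "(y, z) \<in> list_order xs"
    then have "x \<in> set xs" "y \<in> set xs" "z \<in> set xs" using list_order_subset by blast+
    then obtain i j k where "x = xs ! i" "y = xs ! j" "z = xs ! k"
      "i < length xs" "j < length xs" "k < length xs" by (metis in_set_conv_nth)
    then show "(x, z) \<in> list_order xs" using xy yz by (auto simp: iff)
  qed
  moreover have "antisym (list_order xs)"
  proof (rule antisymI)
    fix x y assume xy: "(x, y) \<in> list_order xs" and yx: "(y, x) \<in> list_order xs"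
    then have "x \<in> set xs" "y \<in> set xs" using list_order_subset by blast+
    then obtain i j where "x = xs ! i" "y = xs ! j" "i < length xs" "j < length xs"
      by (metis in_set_conv_nth)
    then show "x = y" using xy yx by (auto simp: iff)
  qed
  moreover have "refl_on (set xs) (list_order xs)"
    by (auto simp: refl_on_def in_set_conv_nth iff)
  moreover have "total_on (set xs) (list_order xs)"
    by (auto simp: total_on_def in_set_conv_nth iff)
  ultimately show ?thesis
    using list_order_subset by (auto simp: linear_order_on_def partial_order_on_def preorder_on_def)
qed

lemma list_order_inject:
  assumes xs: "distinct xs" and ys: "distinct ys" and set: "set xs = set ys"
    and eq: "list_order xs = list_order ys"
  shows "xs = ys"
proof (rule nth_equalityI)
  \<comment> \<open>The index of an element can be read off from the number of elements above it.\<close>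
  have card: "card {V. (zs ! j, V) \<in> list_order zs} = Suc j" if zs: "distinct zs" and j: "j < length zs"
    for zs :: "'a list" and j
  proof -
    have "{V. (zs ! j, V) \<in> list_order zs} = set (take (Suc j) zs)"
    proof (intro equalityI subsetI)
      fix V assume V: "V \<in> {V. (zs ! j, V) \<in> list_order zs}"
      then have "V \<in> set zs" using list_order_subset[of zs] by auto
      then obtain k where "V = zs ! k" "k < length zs" by (metis in_set_conv_nth)
      then show "V \<in> set (take (Suc j) zs)"
        using V zs j by (auto simp: in_list_order_iff in_set_conv_nth intro!: exI[of _ k])
    next
      fix V assume "V \<in> set (take (Suc j) zs)"
      then obtain k where "V = zs ! k" "k \<le> j" using j by (auto simp: in_set_conv_nth)
      then show "V \<in> {V. (zs ! j, V) \<in> list_order zs}" using zs j by (simp add: in_list_order_iff)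
    qed
    then show ?thesis using zs j by (simp add: distinct_card)
  qed
  show len: "length xs = length ys"
    using distinct_card[OF xs] distinct_card[OF ys] set by simp
  fix j assume j: "j < length xs"
  then have "xs ! j \<in> set ys" unfolding set[symmetric] by (rule nth_mem)
  then obtain j' where j': "j' < length ys" "xs ! j = ys ! j'" by (metis in_set_conv_nth)
  then have "j = j'" using card[OF xs j] card[OF ys j'(1)] eq by simp
  then show "xs ! j = ys ! j" using j'(2) by simp
qed

text \<open>Later in the list means smaller, so the elements are sorted by the number of elements above them.\<close>

lemma ex_list_order:
  assumes "finite P" and r: "linear_order_on P r"
  obtains xs where "distinct xs" "set xs = P" "list_order xs = r"
proof -
  define rank where "rank V = card {W. (V, W) \<in> r}" for V
  have sub: "r \<subseteq> P \<times> P" and "trans r" and "antisym r" and "refl_on P r" and "total_on P r"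
    using r by (auto simp: linear_order_on_def partial_order_on_def preorder_on_def)
  have strict: "rank W < rank V" if "(V, W) \<in> r" "V \<noteq> W" for V W
    unfolding rank_def
  proof (rule psubset_card_mono)
    show "finite {W. (V, W) \<in> r}" by (rule finite_subset[OF _ assms(1)]) (use sub in auto)
    have "V \<in> P" using that sub by auto
    then have "(V, V) \<in> r" using \<open>refl_on P r\<close> by (simp add: refl_on_def)
    moreover have "(W, V) \<notin> r" using that \<open>antisym r\<close> by (auto dest: antisymD)
    ultimately show "{U. (W, U) \<in> r} \<subset> {U. (V, U) \<in> r}"
      using that \<open>trans r\<close> by (auto dest: transD)
  qed
  obtain ys where ys: "distinct ys" "set ys = P" using finite_distinct_list[OF assms(1)] by blast
  define xs where "xs = sort_key rank ys"
  have xs: "distinct xs" "set xs = P" "sorted (map rank xs)" using ys by (simp_all add: xs_def)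
  have le: "(xs ! j, xs ! k) \<in> r" if "k \<le> j" "j < length xs" for j k
  proof (rule ccontr)
    assume no: "(xs ! j, xs ! k) \<notin> r"
    have P: "xs ! j \<in> P" "xs ! k \<in> P" using that xs(2) by auto
    with no \<open>refl_on P r\<close> have "xs ! j \<noteq> xs ! k" by (auto simp: refl_on_def)
    with P no \<open>total_on P r\<close> have "(xs ! k, xs ! j) \<in> r" by (auto simp: total_on_def)
    then have "rank (xs ! j) < rank (xs ! k)" using \<open>xs ! j \<noteq> xs ! k\<close> by (auto intro: strict)
    moreover have "rank (xs ! k) \<le> rank (xs ! j)"
      using sorted_nth_mono[OF xs(3), of k j] that by simp
    ultimately show False by simp
  qed
  have "list_order xs = r"
  proof (intro equalityI subrelI)
    fix V W assume VW: "(V, W) \<in> r"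
    then have "V \<in> set xs" "W \<in> set xs" using sub xs(2) by auto
    then obtain j k where jk: "V = xs ! j" "W = xs ! k" "j < length xs" "k < length xs"
      by (metis in_set_conv_nth)
    show "(V, W) \<in> list_order xs"
    proof (cases "k \<le> j")
      case False
      then have "(W, V) \<in> r" using le[of j k] jk by simp
      then have "V = W" using VW \<open>antisym r\<close> by (auto dest: antisymD)
      then show ?thesis using jk False by (simp add: in_list_order_iff[OF xs(1)])
    qed (use jk in \<open>simp add: in_list_order_iff[OF xs(1)]\<close>)
  qed (auto simp: list_order_def intro: le)
  then show thesis using that xs by blast
qed

section \<open>Bi-monotone pair partitions as configurations\<close>

definition closed_configs :: "(nat \<Rightarrow> face) \<Rightarrow> nat set \<Rightarrow> nat set list set" where
  "closed_configs \<phi> A = {xs \<in> configs \<phi> A. \<forall>V\<in>set xs. card V = 2}"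

lemma closed_configs_length:
  assumes "xs \<in> closed_configs \<phi> A"
  shows "card A = 2 * length xs"
proof -
  have *: "sorted_wrt (compatible \<phi>) xs \<Longrightarrow> \<forall>V\<in>set xs. card V = 2
      \<Longrightarrow> card (\<Union>(set xs)) = 2 * length xs"
  proof (induction xs)
    case (Cons X xs)
    have fin: "finite V" if "V \<in> set (X # xs)" for V
    proof -
      have "card V = 2" using Cons.prems(2) that by blast
      then show ?thesis by (intro card_ge_0_finite) simp
    qed
    have "X \<inter> \<Union>(set xs) = {}" using Cons.prems(1) by (auto simp: compatible_def)
    then have "card (X \<union> \<Union>(set xs)) = card X + card (\<Union>(set xs))"
      using fin by (intro card_Un_disjoint) auto
    then show ?case using Cons by simp
  qed simp
  show ?thesis using * assms by (simp add: closed_configs_def configs_def)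
qed

lemma spans_pair: "card V = 2 \<Longrightarrow> spans V b \<longleftrightarrow> (\<exists>a\<in>V. \<exists>c\<in>V. a < b \<and> b < c)"
  by (auto simp: spans_def)

text \<open>For pairs, \<open>b\<close> is spanned by a block iff it lies strictly between its two elements. Compatibility
  forbids the wrong order of two blocks where bi-monotonicity demands the right one; these are
  equivalent because the order is total.\<close>

lemma bi_monotone_list_order_iff:
  assumes "distinct xs" "\<forall>V\<in>set xs. card V = 2"
  shows "bi_monotone \<phi> (set xs) (list_order xs) \<and> disjoint (set xs)
    \<longleftrightarrow> sorted_wrt (compatible \<phi>) xs"
proof
  assume *: "bi_monotone \<phi> (set xs) (list_order xs) \<and> disjoint (set xs)"
  have "compatible \<phi> (xs ! p) (xs ! q)" if pq: "p < q" "q < length xs" for p q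
  proof -
    have mem: "xs ! p \<in> set xs" "xs ! q \<in> set xs" using pq by auto
    have no: "(xs ! p, xs ! q) \<notin> list_order xs" using pq assms(1) by (simp add: in_list_order_iff)
    have "xs ! p \<noteq> xs ! q" using pq assms(1) by (simp add: nth_eq_iff_index_eq)
    then have "xs ! p \<inter> xs ! q = {}" using * mem by (auto dest: disjointD)
    moreover have "\<not> spans (xs ! q) b" if "b \<in> xs ! p" "\<phi> b = Right_Face" for b
    proof
      assume "spans (xs ! q) b"
      then obtain a c where "a \<in> xs ! q" "c \<in> xs ! q" "a < b" "b < c"
        using assms(2) mem by (auto simp: spans_pair)
      with * mem that have "case \<phi> b of Right_Face \<Rightarrow> (xs ! p, xs ! q) \<in> list_order xs
          | Left_Face \<Rightarrow> (xs ! q, xs ! p) \<in> list_order xs"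
        unfolding bi_monotone_def by blast
      with that no show False by simp
    qed
    moreover have "\<not> spans (xs ! p) b" if "b \<in> xs ! q" "\<phi> b = Left_Face" for b
    proof
      assume "spans (xs ! p) b"
      then obtain a c where "a \<in> xs ! p" "c \<in> xs ! p" "a < b" "b < c"
        using assms(2) mem by (auto simp: spans_pair)
      with * mem that have "case \<phi> b of Right_Face \<Rightarrow> (xs ! q, xs ! p) \<in> list_order xs
          | Left_Face \<Rightarrow> (xs ! p, xs ! q) \<in> list_order xs"
        unfolding bi_monotone_def by blast
      with that no show False by simp
    qed
    ultimately show ?thesis by (auto simp: compatible_def)
  qed
  then show "sorted_wrt (compatible \<phi>) xs" by (simp add: sorted_wrt_iff_nth_less)
next
  assume "sorted_wrt (compatible \<phi>) xs"
  then have comp: "compatible \<phi> (xs ! p) (xs ! q)" if "p < q" "q < length xs" for p q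
    using that by (simp add: sorted_wrt_iff_nth_less)
  have "disjoint (set xs)"
  proof (rule disjointI)
    fix V W assume "V \<in> set xs" "W \<in> set xs" "V \<noteq> W"
    then obtain p q where pq: "V = xs ! p" "W = xs ! q" "p < length xs" "q < length xs" "p \<noteq> q"
      by (metis in_set_conv_nth)
    show "V \<inter> W = {}"
      using comp[of p q] comp[of q p] pq by (cases "p < q") (auto simp: compatible_def)
  qed
  moreover have "bi_monotone \<phi> (set xs) (list_order xs)"
    unfolding bi_monotone_def
  proof (intro ballI impI)
    fix V W a b c
    assume V: "V \<in> set xs" and W: "W \<in> set xs" and abc: "a \<in> V" "c \<in> V" "b \<in> W" "a < b \<and> b < c"
    obtain p q where pq: "V = xs ! p" "W = xs ! q" "p < length xs" "q < length xs"
      using V W by (metis in_set_conv_nth)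
    have "spans V b" using V abc assms(2) by (auto simp: spans_pair)
    then have "p \<le> q" if "\<phi> b = Right_Face"
      using comp[of q p] that pq abc by (auto simp: compatible_def not_le[symmetric])
    moreover have "q \<le> p" if "\<phi> b = Left_Face"
      using comp[of p q] that pq abc \<open>spans V b\<close> by (auto simp: compatible_def not_le[symmetric])
    ultimately show "case \<phi> b of Right_Face \<Rightarrow> (W, V) \<in> list_order xs
        | Left_Face \<Rightarrow> (V, W) \<in> list_order xs"
      using pq assms(1) by (cases "\<phi> b") (simp_all add: in_list_order_iff)
  qed
  ultimately show "bi_monotone \<phi> (set xs) (list_order xs) \<and> disjoint (set xs)" by simp
qed

text \<open>A configuration without live blocks is a pair partition together with the list of its blocks, that
  is, with a total order on them; the pairwise compatibility of the blocks is
  bi-monotonicity.\<close>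

lemma card_bi_monotone_pair_partitions:
  "card (bi_monotone_pair_partitions \<delta>) = card (closed_configs (\<lambda>i. \<delta> ! (i - 1)) {0<..length \<delta>})"
proof -
  let ?\<phi> = "\<lambda>i. \<delta> ! (i - 1)" and ?A = "{0<..length \<delta>}"
  have A: "{1..length \<delta>} = ?A" by auto
  have iff: "xs \<in> closed_configs ?\<phi> ?A \<longleftrightarrow> (set xs, list_order xs) \<in> bi_monotone_pair_partitions \<delta>"
    if xs: "distinct xs" for xs
  proof (cases "\<forall>V\<in>set xs. card V = 2")
    case True
    then have "{} \<notin> set xs" by force
    have "xs \<in> closed_configs ?\<phi> ?A
        \<longleftrightarrow> \<Union>(set xs) = ?A \<and> sorted_wrt (compatible ?\<phi>) xs"
      unfolding closed_configs_def configs_def using True by blast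
    moreover have "(set xs, list_order xs) \<in> bi_monotone_pair_partitions \<delta>
        \<longleftrightarrow> \<Union>(set xs) = ?A \<and> bi_monotone ?\<phi> (set xs) (list_order xs) \<and> disjoint (set xs)"
      unfolding bi_monotone_pair_partitions_def ordered_partition_on_def partition_on_def A
      using True \<open>{} \<notin> set xs\<close> linear_order_list_order[OF xs] by blast
    ultimately show ?thesis
      using bi_monotone_list_order_iff[OF xs True, of ?\<phi>] by (simp only:)
  qed (auto simp: closed_configs_def bi_monotone_pair_partitions_def)
  have distinct: "distinct xs" if "xs \<in> closed_configs ?\<phi> ?A" for xs
    using that configs_distinct by (auto simp: closed_configs_def)
  have "bij_betw (\<lambda>xs. (set xs, list_order xs)) (closed_configs ?\<phi> ?A) (bi_monotone_pair_partitions \<delta>)"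
    unfolding bij_betw_def
  proof (intro conjI inj_onI equalityI subsetI)
    fix xs ys assume "xs \<in> closed_configs ?\<phi> ?A" "ys \<in> closed_configs ?\<phi> ?A"
      and "(set xs, list_order xs) = (set ys, list_order ys)"
    then show "xs = ys" by (intro list_order_inject distinct) simp_all
  next
    fix p assume "p \<in> (\<lambda>xs. (set xs, list_order xs)) ` closed_configs ?\<phi> ?A"
    then show "p \<in> bi_monotone_pair_partitions \<delta>" using iff distinct by blast
  next
    fix p assume p: "p \<in> bi_monotone_pair_partitions \<delta>"
    obtain P r where Pr: "p = (P, r)" by (cases p)
    with p have part: "partition_on {1..length \<delta>} P" and lin: "linear_order_on P r"
      by (auto simp: bi_monotone_pair_partitions_def ordered_partition_on_def)
    have "finite P" using part finite_elements by blast
    then obtain xs where xs: "distinct xs" "set xs = P" "list_order xs = r"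
      using ex_list_order[OF _ lin] by blast
    then show "p \<in> (\<lambda>xs. (set xs, list_order xs)) ` closed_configs ?\<phi> ?A"
      using iff[OF xs(1)] p Pr by auto
  qed
  then show ?thesis by (rule bij_betw_same_card[symmetric])
qed

text \<open>At the empty tuple only words without live letters have nonzero density, and theirs is the volume
  \<open>1 / n!\<close> of the simplex of increasing \<open>n\<close>-tuples in \<open>[0, 1]\<close>.\<close>

lemma vacuum_expectation_closed:
  "fock_inner vacuum (operator_product (map (field_operator 0 1) \<delta>) vacuum)
    = of_real (\<Sum>xs\<in>closed_configs (\<lambda>i. \<delta> ! (i - 1)) {0<..length \<delta>}. 1 / fact (length xs))"
proof -
  let ?\<phi> = "\<lambda>i. \<delta> ! (i - 1)" and ?A = "{0<..length \<delta>}"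
  have "(\<Sum>xs\<in>configs ?\<phi> ?A. density 0 1 [] (live_word xs))
      = (\<Sum>xs\<in>closed_configs ?\<phi> ?A. density 0 1 [] (live_word xs))"
  proof (rule sum.mono_neutral_right)
    show "finite (configs ?\<phi> ?A)" by (rule finite_configs) simp
    show "closed_configs ?\<phi> ?A \<subseteq> configs ?\<phi> ?A" by (auto simp: closed_configs_def)
    show "\<forall>xs\<in>configs ?\<phi> ?A - closed_configs ?\<phi> ?A. density 0 1 [] (live_word xs) = 0"
    proof
      fix xs assume "xs \<in> configs ?\<phi> ?A - closed_configs ?\<phi> ?A"
      then obtain V where "V \<in> set xs" "card V = 1"
        unfolding closed_configs_def configs_def by blast
      then have "True \<in> set (live_word xs)" by (auto intro!: rev_image_eqI)
      then show "density 0 1 [] (live_word xs) = 0" by simp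
    qed
  qed
  also have "\<dots> = (\<Sum>xs\<in>closed_configs ?\<phi> ?A. 1 / fact (length xs))"
    by (intro sum.cong) (auto simp: closed_configs_def divided_power_def)
  finally show ?thesis by (simp only: vacuum_expectation)
qed

theorem theorem7p1:
  shows "(\<forall>n. \<forall>\<delta>. length \<delta> = 2 * n \<longrightarrow>
      fock_inner vacuum (operator_product (map (field_operator 0 1) \<delta>) vacuum)
        = complex_of_real (1 / fact n * real (card (bi_monotone_pair_partitions \<delta>))))
    \<and> (\<forall>\<delta>. odd (length \<delta>) \<longrightarrow>
      fock_inner vacuum (operator_product (map (field_operator 0 1) \<delta>) vacuum) = 0)"
proof (intro conjI allI impI)
  fix n and \<delta> :: "face list"
  assume n: "length \<delta> = 2 * n"
  let ?C = "closed_configs (\<lambda>i. \<delta> ! (i - 1)) {0<..length \<delta>}"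
  have "length xs = n" if "xs \<in> ?C" for xs using closed_configs_length[OF that] n by simp
  then have "(\<Sum>xs\<in>?C. 1 / fact (length xs)) = (\<Sum>xs\<in>?C. 1 / fact n :: real)" by (intro sum.cong) simp_all
  then show "fock_inner vacuum (operator_product (map (field_operator 0 1) \<delta>) vacuum)
      = complex_of_real (1 / fact n * real (card (bi_monotone_pair_partitions \<delta>)))"
    by (simp add: vacuum_expectation_closed card_bi_monotone_pair_partitions)
next
  fix \<delta> :: "face list"
  assume odd: "odd (length \<delta>)"
  have "closed_configs (\<lambda>i. \<delta> ! (i - 1)) {0<..length \<delta>} = {}"
    using closed_configs_length[of _ _ "{0<..length \<delta>}"] odd by fastforce
  then show "fock_inner vacuum (operator_product (map (field_operator 0 1) \<delta>) vacuum) = 0"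
    by (simp add: vacuum_expectation_closed)
qed

end
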